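(* Let $K\subset[0,1]$ be the attractor of a homogeneous linear iterated function system $\{\phi_j(x)=\rho x+a_j\}_{j=1}^L$ satisfying the strong separation condition, let $T:K\to K$ be the map induced by the shift, and let $\gamma:=\dim_H K=\frac{\log L}{-\log\rho}$. For $\psi:\mathbb{N}\to\mathbb{R}^+$ set $$R(\psi):=\{x\in K:\ |T^n x-x|<\psi(n)\ \text{for infinitely many } n\in\mathbb{N}\}.$$ Let $b>0$, let $f(r)=r^{\frac{\gamma}{1+b}}$, and let $\varphi(n)=\rho^{bn}$. For $\eta>0$ let $$\varphi_\eta(n)=\rho^{bn}\big(\log\rho^{-n}\big)^{-\frac{(1+b)(1+\eta)}{\gamma}}.$$ Then for any $\eta>0$, $$\mathcal{H}^f(R(\varphi))=\infty\quad\text{and}\quad \mathcal{H}^f(R(\varphi_\eta))=0.$$ In particular, the set $R(\varphi)\setminus R(\varphi_\eta)$ is uncountable.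
   Context: Setting. Let $L\ge 2$ be an integer, $\rho\in(0,1)$, and $0\le a_1<\cdots<a_L\le 1-\rho$. Put $\phi_j(x)=\rho x+a_j$ on $[0,1]$ for $1\le j\le L$. The attractor $K$ is the unique non-empty compact subset of $[0,1]$ with $K=\bigcup_{j=1}^L\phi_j(K)$. The strong separation condition means that the sets $\phi_1(K),\dots,\phi_L(K)$ are pairwise disjoint (as a consequence $\rho<1/L$). Coding. Let $\Lambda=\{1,\dots,L\}$. For $\epsilon=(\epsilon_1,\epsilon_2,\dots)\in\Lambda^{\mathbb{N}}$ let $\pi(\epsilon)$ be the unique point of $\bigcap_{n\ge1}\phi_{\epsilon_1}\circ\cdots\circ\phi_{\epsilon_n}([0,1])$. Then $K=\pi(\Lambda^{\mathbb{N}})$, and each $x\in K$ has a unique coding, i.e. a unique $\epsilon$ with $\pi(\epsilon)=x$. Map. $T:K\to K$ is defined by $Tx=\pi(\sigma(\epsilon))$ where $\epsilon$ is the coding of $x$ and $\sigma$ is the left shift on $\Lambda^{\mathbb{N}}$. Hausdorff measure. For $f(r)=r^s$ with $s>0$, $\mathcal{H}^f$ is the $s$-dimensional Hausdorff measure $\mathcal{H}^s$: for a subset $F$ of a separable metric space $X$ (here $X=K$ with the Euclidean metric), $$\mathcal{H}^f(F)=\lim_{\tau\to0}\inf\Big\{\sum_{i\ge1}f(2r_i):\ F\subset\bigcup_{i\ge 1}B(x_i,r_i),\ r_i\le\tau \text{ for all } i\Big\},$$ the infimum being over countable collections of open balls $B(x_i,r_i)$ in $X$. Here $\dim_H$ is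 Hausdorff dimension, $|\cdot|$ is the Euclidean metric, $\mathbb{N}=\{1,2,\dots\}$, and $\mathbb{R}^+=(0,\infty)$. *)

theory Defs
  imports "HOL-Analysis.Analysis"
begin

definition ifs_map :: "real \<Rightarrow> (nat \<Rightarrow> real) \<Rightarrow> nat \<Rightarrow> real \<Rightarrow> real" where
  "ifs_map \<rho> a j x = \<rho> * x + a j"

definition is_attractor :: "nat \<Rightarrow> real \<Rightarrow> (nat \<Rightarrow> real) \<Rightarrow> real set \<Rightarrow> bool" where
  "is_attractor L \<rho> a K \<longleftrightarrow>
     compact K \<and> K \<noteq> {} \<and> K \<subseteq> {0..1} \<and> K = (\<Union>j\<in>{1..L}. ifs_map \<rho> a j ` K)"

definition strong_separation :: "nat \<Rightarrow> real \<Rightarrow> (nat \<Rightarrow> real) \<Rightarrow> real set \<Rightarrow> bool" where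
  "strong_separation L \<rho> a K \<longleftrightarrow> disjoint_family_on (\<lambda>j. ifs_map \<rho> a j ` K) {1..L}"

text \<open>Symbol sequences are indexed from 0, so \<open>e 0\<close> is the first symbol and
  \<open>cylinder_map \<rho> a e n\<close> is the composition of the maps of the first n symbols,
  the map of the first symbol being applied last.\<close>

definition symbol_space :: "nat \<Rightarrow> (nat \<Rightarrow> nat) set" where
  "symbol_space L = {e. \<forall>n. e n \<in> {1..L}}"

fun cylinder_map :: "real \<Rightarrow> (nat \<Rightarrow> real) \<Rightarrow> (nat \<Rightarrow> nat) \<Rightarrow> nat \<Rightarrow> real \<Rightarrow> real" where
  "cylinder_map \<rho> a e 0 = id"
| "cylinder_map \<rho> a e (Suc n) = cylinder_map \<rho> a e n \<circ> ifs_map \<rho> a (e n)"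

definition coding_map :: "real \<Rightarrow> (nat \<Rightarrow> real) \<Rightarrow> (nat \<Rightarrow> nat) \<Rightarrow> real" where
  "coding_map \<rho> a e = (THE x. x \<in> (\<Inter>n\<in>{1..}. cylinder_map \<rho> a e n ` {0..1}))"

definition coding :: "nat \<Rightarrow> real \<Rightarrow> (nat \<Rightarrow> real) \<Rightarrow> real \<Rightarrow> nat \<Rightarrow> nat" where
  "coding L \<rho> a x = (THE e. e \<in> symbol_space L \<and> coding_map \<rho> a e = x)"

text \<open>The map induced by the left shift; its values are meaningful on the attractor only.\<close>

definition shift_map :: "nat \<Rightarrow> real \<Rightarrow> (nat \<Rightarrow> real) \<Rightarrow> real \<Rightarrow> real" where
  "shift_map L \<rho> a x = coding_map \<rho> a (\<lambda>n. coding L \<rho> a x (Suc n))"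

definition recurrent_set ::
  "nat \<Rightarrow> real \<Rightarrow> (nat \<Rightarrow> real) \<Rightarrow> real set \<Rightarrow> (nat \<Rightarrow> real) \<Rightarrow> real set" where
  "recurrent_set L \<rho> a K \<psi> =
     {x \<in> K. infinite {n. 1 \<le> n \<and> \<bar>(shift_map L \<rho> a ^^ n) x - x\<bar> < \<psi> n}}"

text \<open>Balls are those of the subspace X: centres lie in X, and \<open>ball (x i) (r i) \<inter> X\<close> is the
  ball of X. The index set I allows finite as well as infinite families of balls.\<close>

definition ball_cover ::
  "'a::metric_space set \<Rightarrow> real \<Rightarrow> 'a set \<Rightarrow> nat set \<Rightarrow> (nat \<Rightarrow> 'a) \<Rightarrow> (nat \<Rightarrow> real) \<Rightarrow> bool" where
  "ball_cover X \<tau> F I x r \<longleftrightarrow>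
     (\<forall>i\<in>I. x i \<in> X \<and> 0 < r i \<and> r i \<le> \<tau>) \<and> F \<subseteq> (\<Union>i\<in>I. ball (x i) (r i) \<inter> X)"

definition hausdorff_premeasure ::
  "(real \<Rightarrow> real) \<Rightarrow> 'a::metric_space set \<Rightarrow> real \<Rightarrow> 'a set \<Rightarrow> ennreal" where
  "hausdorff_premeasure f X \<tau> F =
     Inf {(\<Sum>i. if i \<in> I then ennreal (f (2 * r i)) else 0) | I x r. ball_cover X \<tau> F I x r}"

definition hausdorff_measure ::
  "(real \<Rightarrow> real) \<Rightarrow> 'a::metric_space set \<Rightarrow> 'a set \<Rightarrow> ennreal" where
  "hausdorff_measure f X F = Lim (at_right 0) (\<lambda>\<tau>. hausdorff_premeasure f X \<tau> F)"

lemma hausdorff_premeasure_antimono: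
  assumes "\<tau> \<le> \<tau>'"
  shows "hausdorff_premeasure f X \<tau>' F \<le> hausdorff_premeasure f X \<tau> F"
  unfolding hausdorff_premeasure_def
proof (rule Inf_superset_mono)
  have "ball_cover X \<tau>' F I x r" if "ball_cover X \<tau> F I x r" for I x r
    using that assms unfolding ball_cover_def by (meson order_trans)
  then show "{(\<Sum>i. if i \<in> I then ennreal (f (2 * r i)) else 0) | I x r. ball_cover X \<tau> F I x r}
      \<subseteq> {(\<Sum>i. if i \<in> I then ennreal (f (2 * r i)) else 0) | I x r. ball_cover X \<tau>' F I x r}"
    by blast
qed

text \<open>The limit defining the Hausdorff measure always exists.\<close>

lemma hausdorff_premeasure_tendsto:
  "((\<lambda>\<tau>. hausdorff_premeasure f X \<tau> F) \<longlongrightarrow> hausdorff_measure f X F) (at_right 0)"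
proof -
  let ?S = "SUP \<tau>\<in>{0<..}. hausdorff_premeasure f X \<tau> F"
  have "((\<lambda>\<tau>. hausdorff_premeasure f X \<tau> F) \<longlongrightarrow> ?S) (at_right 0)"
  proof (rule order_tendstoI)
    fix y assume "y < ?S"
    then obtain \<tau>0 where "0 < \<tau>0" and y: "y < hausdorff_premeasure f X \<tau>0 F"
      unfolding less_SUP_iff by blast
    have "y < hausdorff_premeasure f X \<tau> F" if "\<tau> < \<tau>0" for \<tau>
      by (rule less_le_trans[OF y hausdorff_premeasure_antimono]) (use that in linarith)
    then show "eventually (\<lambda>\<tau>. y < hausdorff_premeasure f X \<tau> F) (at_right 0)"
      unfolding eventually_at_right_field using \<open>0 < \<tau>0\<close> by blast
  next
    fix y assume y: "?S < y"
    have "hausdorff_premeasure f X \<tau> F < y" if "0 < \<tau>" for \<tau>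
      by (rule le_less_trans[OF SUP_upper y]) (use that in simp)
    then show "eventually (\<lambda>\<tau>. hausdorff_premeasure f X \<tau> F < y) (at_right 0)"
      unfolding eventually_at_right_field by (intro exI[of _ 1]) simp
  qed
  then show ?thesis
    unfolding hausdorff_measure_def 
    using tendsto_Lim[OF trivial_limit_at_right_real] by metis
qed

text \<open>For a subset of a Euclidean space the set below contains every s exceeding the
  dimension of the space, so the infimum is a genuine one and a real number suffices.\<close>

definition hausdorff_dim :: "'a::euclidean_space set \<Rightarrow> real" where
  "hausdorff_dim F = Inf {s. 0 < s \<and> hausdorff_measure (\<lambda>r. r powr s) F F = 0}"

end

theory Submission
  imports Defs "HOL-Library.Sublist"
begin

text \<open>Write \<open>\<gamma> = ln L / (- ln \<rho>)\<close>, so that \<open>\<rho> powr \<gamma> = 1 / L\<close>, and \<open>s = \<gamma> / (1 + b)\<close>.  Under strong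
separation the distance of two points of \<open>K\<close> is comparable to \<open>\<rho> ^ l\<close>, where \<open>l\<close> is the length
of the common prefix of their codings.  Hence balls may be replaced by cylinders, a cylinder of
length \<open>l\<close> costs about \<open>L powr (- l / (1 + b))\<close> when diameters are raised to the power \<open>s\<close>, and \<open>x\<close>
lies within \<open>\<rho> powr (b * n)\<close> of its \<open>n\<close>-th iterate as soon as the first \<open>n\<close> symbols of its coding
are continued with period \<open>n\<close> over slightly more than \<open>b * n\<close> further places.

\<^bold>\<open>Infinite measure.\<close>  For each \<open>n\<close> there are \<open>L ^ n\<close> such periodic cylinders, each of cost about
\<open>L powr (- n)\<close>.  A cover of finite cost that is fine enough misses a recurrent point.  That point is built
by extending a finite word step by step so that, at each stage, the cylinder of the current word
is at least half free: the Bernoulli masses of its intersections with the covering cylinders add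
up to at most half of its own mass.  One level \<open>n\<close> suffices for a step, because the cost series of
the cover converges: for large \<open>n\<close> the covering words of length at least \<open>n\<close> have a total cost
far below the \<open>L powr (- n)\<close> per word of length \<open>n\<close> that would be needed to spoil all periodic
extensions (\<open>extend_half_free\<close>, \<open>recurrent_sequence_avoiding_words\<close>).  So fine covers of the
recurrent set have arbitrarily large cost (\<open>hausdorff_measure_recurrent_set_eq_top\<close>).

\<^bold>\<open>Measure zero.\<close>  On a cylinder of length \<open>n\<close> the \<open>n\<close>-th iterate is affine with slope \<open>1 / \<rho> ^ n\<close>, so the points
of that cylinder with \<open>n\<close>-th return closer than \<open>t\<close> lie in one ball of radius about \<open>\<rho> ^ n * t\<close>.
For the rate with the logarithmic factor the resulting costs are, up to a constant,
\<open>n powr (- (1 + \<eta>))\<close>, and the tail covers of the upper limit set have vanishing cost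
(\<open>hausdorff_measure_limsup_eq_0\<close>).

\<^bold>\<open>Consequences.\<close>  The constant rate 2 makes every point of \<open>K\<close> recurrent, so the convergence argument
bounds the dimension of \<open>K\<close> from above; the infinite measures for all \<open>b > 0\<close> bound it from below,
since \<open>\<gamma> / (1 + b)\<close> takes every value in \<open>(0, \<gamma>)\<close>.  If the difference of the two recurrent sets were
countable, the first one would be contained in the union of the second with a countable set; that
union still has measure zero, because \<open>n + 1\<close> extra balls at level \<open>n\<close> at most double the number of
balls used.\<close>

section \<open>Words and Bernoulli mass\<close>

definition words :: "nat \<Rightarrow> nat \<Rightarrow> nat list set" where
  "words L n = {w. set w \<subseteq> {1..L} \<and> length w = n}"

lemma finite_words: "finite (words L n)"
  unfolding words_def by (rule finite_lists_length_eq) simp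

lemma card_words: "card (words L n) = L ^ n"
  unfolding words_def using card_lists_length_eq[of "{1..L}" n] by simp

lemma words_Suc: "words L (Suc n) = (\<lambda>(j, v). j # v) ` ({1..L} \<times> words L n)"
  unfolding words_def by (auto simp: length_Suc_conv image_iff)

text \<open>The mass of the intersection of the cylinders of \<open>c\<close> and \<open>u\<close> under the Bernoulli measure that
gives all \<open>L\<close> symbols the same weight.\<close>
definition overlap :: "nat \<Rightarrow> nat list \<Rightarrow> nat list \<Rightarrow> real" where
  "overlap L c u =
     (if prefix c u \<or> prefix u c then (1 / real L) ^ max (length c) (length u) else 0)"

lemma overlap_nonneg: "0 \<le> overlap L c u"
  by (simp add: overlap_def)

lemma overlap_prefix: "prefix c u \<Longrightarrow> overlap L c u = (1 / real L) ^ length u"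
  by (auto simp: overlap_def max_def dest: prefix_length_le)

lemma sum_overlap_letters:
  assumes c: "set c \<subseteq> {1..L}" and L: "1 \<le> L"
  shows "(\<Sum>j\<in>{1..L}. overlap L c (u @ [j])) = overlap L c u"
proof -
  consider "prefix c u" | "strict_prefix u c" | "\<not> prefix c u" "\<not> prefix u c"
    by (auto simp: strict_prefix_def)
  then show ?thesis
  proof cases
    case 1
    then have "overlap L c (u @ [j]) = (1 / real L) ^ Suc (length u)" for j
      by (subst overlap_prefix) auto
    then show ?thesis using L overlap_prefix[OF 1, of L] by simp
  next
    case 2
    then obtain j0 d where d: "c = u @ j0 # d" by (rule strict_prefixE')
    have j0: "j0 \<in> {1..L}" using c d by auto
    have "overlap L c (u @ [j]) = (if j = j0 then (1 / real L) ^ length c else 0)" for j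
      by (auto simp: overlap_def d prefix_def)
    then have "(\<Sum>j\<in>{1..L}. overlap L c (u @ [j])) = (1 / real L) ^ length c"
      using j0 by (simp add: sum.delta)
    then show ?thesis by (simp add: overlap_def d)
  next
    case 3
    have "overlap L c (u @ [j]) = 0 " for j
      using 3 by (auto simp: overlap_def prefix_snoc dest: append_prefixD)
    then show ?thesis using 3 by (simp add: overlap_def)
  qed
qed

text \<open>Additivity of the Bernoulli measure over the partition of a cylinder into longer ones.\<close>
lemma sum_overlap_words:
  assumes c: "set c \<subseteq> {1..L}" and L: "1 \<le> L"
  shows "(\<Sum>v\<in>words L k. overlap L c (u @ v)) = overlap L c u"
proof (induction k arbitrary: u)
  case 0
  have "words L 0 = {[]}" by (auto simp: words_def)
  then show ?case by simp
next
  case (Suc k)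
  have "(\<Sum>v\<in>words L (Suc k). overlap L c (u @ v)) =
      (\<Sum>(j, v)\<in>{1..L} \<times> words L k. overlap L c ((u @ [j]) @ v))"
    unfolding words_Suc by (subst sum.reindex) (auto simp: inj_on_def intro!: sum.cong)
  also have "\<dots> = (\<Sum>j\<in>{1..L}. overlap L c (u @ [j]))"
    unfolding sum.cartesian_product[symmetric] Suc.IH ..
  finally show ?case using sum_overlap_letters[OF c L] by simp
qed

text \<open>The form in which convergence is used: the indices are selected by a length function rather than by
their position.  Only finitely many lengths occur before the position from which the ordinary tail
is small, so a threshold above all of these lengths works.\<close>
lemma suminf_tail_le:
  fixes g :: "nat \<Rightarrow> real" and len :: "nat \<Rightarrow> nat"
  assumes g: "summable g" "\<And>i. 0 \<le> g i" and e: "0 < e"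
  obtains n where "N \<le> n" "(\<Sum>i. if n \<le> len i then g i else 0) < e"
proof -
  obtain i0 where i0: "norm (\<Sum>i. g (i + i0)) < e"
    using suminf_exist_split[OF e g(1)] by auto
  define n where "n = N + Suc (Max (len ` {..i0}))"
  have len: "i0 < i" if "n \<le> len i" for i
  proof (rule ccontr)
    assume "\<not> i0 < i"
    then have "len i \<le> Max (len ` {..i0})" by (intro Max_ge) auto
    then show False using that by (simp add: n_def)
  qed
  let ?h = "\<lambda>i. if n \<le> len i then g i else 0"
  have h: "summable ?h"
    by (rule summable_comparison_test'[OF g(1), of 0]) (use g(2) in auto)
  have "(\<Sum>i. ?h i) = (\<Sum>i. ?h (i + i0)) + (\<Sum>i<i0. ?h i)"
    by (rule suminf_split_initial_segment[OF h])
  also have "(\<Sum>i<i0. ?h i) = 0" using len by (intro sum.neutral) fastforce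
  also have "(\<Sum>i. ?h (i + i0)) \<le> (\<Sum>i. g (i + i0))"
    using g(2) by (intro suminf_le summable_ignore_initial_segment[OF h]
        summable_ignore_initial_segment[OF g(1)]) auto
  finally show ?thesis using i0 by (intro that[of n]) (auto simp: n_def)
qed

section \<open>Recurrent sequences avoiding sparse families of words\<close>

definition periodic_ext :: "nat list \<Rightarrow> nat \<Rightarrow> nat list" where
  "periodic_ext w m = map (\<lambda>i. w ! (i mod length w)) [0..<length w + m]"

lemma prefix_periodic_ext: "prefix w (periodic_ext w m)"
proof -
  have "take (length w) (periodic_ext w m) = w"
    by (intro nth_equalityI) (auto simp: periodic_ext_def)
  then show ?thesis by (metis take_is_prefix)
qed

lemma length_periodic_ext [simp]: "length (periodic_ext w m) = length w + m"
  by (simp add: periodic_ext_def)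

lemma set_periodic_ext: "w \<noteq> [] \<Longrightarrow> set (periodic_ext w m) \<subseteq> set w"
  by (auto simp: periodic_ext_def)

lemma nth_periodic_ext:
  "i < m \<Longrightarrow> periodic_ext w m ! (i + length w) = periodic_ext w m ! i"
  by (simp add: periodic_ext_def)

text \<open>A countable family of words, understood as a family of covering cylinders.  The exponent
\<open>1 / (1 + b)\<close> turns the Bernoulli mass of a cylinder into its cost: a word of length
\<open>(1 + b) * n\<close> has mass \<open>(1 / L) powr ((1 + b) * n)\<close> but cost \<open>(1 / L) ^ n\<close>.\<close>
locale sparse_words =
  fixes L :: nat and b :: real and I :: "nat set" and c :: "nat \<Rightarrow> nat list"
  assumes L: "2 \<le> L" and b: "0 < b"
    and alphabet: "\<And>i. i \<in> I \<Longrightarrow> set (c i) \<subseteq> {1..L}"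
    and summable_cost: "summable (\<lambda>i. if i \<in> I then (1 / L) powr (length (c i) / (1 + b)) else 0)"
begin

definition cost :: "nat \<Rightarrow> real" where
  "cost i = (if i \<in> I then (1 / L) powr (length (c i) / (1 + b)) else 0)"

definition covered :: "nat list \<Rightarrow> real" where
  "covered u = (\<Sum>i. if i \<in> I then overlap L (c i) u else 0)"

lemma cost_nonneg: "0 \<le> cost i"
  by (simp add: cost_def)

lemma summable_cost': "summable cost"
  using summable_cost by (simp add: cost_def[abs_def])

lemma powr_inverse_size: "(1 / real L) powr real k = (1 / real L) ^ k"
  using L by (intro powr_realpow) simp

text \<open>A word that is to cover a substantial part of the cylinder of a long word \<open>u\<close> is expensive:
\<open>max x y \<ge> y * b / (1 + b) + x / (1 + b)\<close>, because the right-hand side is a weighted mean of \<open>x\<close>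
and \<open>y\<close>.\<close>
lemma overlap_le_cost:
  assumes "i \<in> I"
  shows "overlap L (c i) u \<le> (1 / L) powr (length u * b / (1 + b)) * cost i"
proof -
  let ?M = "max (length (c i)) (length u)"
  have "length u * b / (1 + b) + length (c i) / (1 + b) \<le> ?M * b / (1 + b) + ?M / (1 + b)"
    using b by (intro add_mono divide_right_mono mult_right_mono) auto
  also have "\<dots> = ?M" using b
    by (simp add: add_divide_distrib[symmetric]) (simp add: field_simps)
  finally have "(1 / L) powr ?M \<le> (1 / L) powr (length u * b / (1 + b) + length (c i) / (1 + b))"
    using L by (intro powr_mono') auto
  also have "\<dots> = (1 / L) powr (length u * b / (1 + b)) * cost i"
    using assms by (simp add: cost_def powr_add)
  finally have "(1 / real L) ^ ?M \<le> (1 / L) powr (length u * b / (1 + b)) * cost i"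
    by (simp only: powr_inverse_size)
  then show ?thesis using cost_nonneg[of i] by (auto simp: overlap_def)
qed

lemma overlap_le_cost': "i \<in> I \<Longrightarrow> overlap L (c i) u \<le> cost i"
proof -
  assume i: "i \<in> I"
  have "(1 / L) powr (length u * b / (1 + b)) \<le> 1"
    using L b by (intro powr_le1) auto
  then show ?thesis using overlap_le_cost[OF i, of u] cost_nonneg[of i]
    by (meson mult_left_le_one_le order_trans powr_ge_zero)
qed

lemma summable_overlap: "summable (\<lambda>i. if i \<in> I then overlap L (c i) u else 0)"
  by (rule summable_comparison_test'[OF summable_cost', of 0])
     (auto simp: overlap_le_cost' overlap_nonneg cost_nonneg)

lemma overlap_le_covered: "i \<in> I \<Longrightarrow> overlap L (c i) u \<le> covered u"
  unfolding covered_def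
  using sum_le_suminf[OF summable_overlap, of "{i}" u] by (simp add: overlap_nonneg)

text \<open>The inductive step of the construction.  Choose \<open>n\<close> so large that the covering words of length at
least \<open>n\<close> have small total cost, and let \<open>w\<close> range over the extensions of \<open>u\<close> of length \<open>n\<close>.  The
periodic extension of \<open>w\<close> fails to be half free only if a covering word shorter than \<open>n\<close> covers
all of \<open>w\<close>, or if the longer covering words that extend \<open>w\<close> cost at least a constant multiple of
\<open>(1 / L) ^ n\<close>.  The words \<open>w\<close> of the first kind make up at most half of all, since \<open>u\<close> is half free,
and those of the second kind less than half by the choice of \<open>n\<close>.\<close>
lemma extend_half_free:
  assumes u: "set u \<subseteq> {1..L}" and half: "covered u \<le> (1 / L) ^ length u / 2"
  obtains w where "set w \<subseteq> {1..L}" "strict_prefix u w"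
    "covered (periodic_ext w (nat \<lfloor>b * length w\<rfloor> + 1)) \<le>
      (1 / L) ^ length (periodic_ext w (nat \<lfloor>b * length w\<rfloor> + 1)) / 2"
proof -
  have "0 < (1 / L) ^ length u / (4 * real L)" using L by simp
  from suminf_tail_le[OF summable_cost' cost_nonneg this, of "Suc (length u)" "\<lambda>i. length (c i)"]
  obtain n where n: "Suc (length u) \<le> n"
    and tail: "(\<Sum>i. if n \<le> length (c i) then cost i else 0) < (1 / L) ^ length u / (4 * real L)"
    by blast
  define V where "V = words L (n - length u)"
  define m where "m = nat \<lfloor>b * n\<rfloor> + 1"
  \<comment> \<open>The contribution of \<open>c i\<close> to the failure at \<open>w\<close>; the factor \<open>2 * L\<close> absorbs the half and the
    rounding of \<open>b * n\<close>, so that a failure at \<open>w\<close> means a total of at least \<open>(1 / L) ^ n\<close>.\<close>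
  define t where "t i w = (if i \<in> I then overlap L (c i) w else 0) +
     2 * L * (if n \<le> length (c i) \<and> prefix w (c i) then cost i else 0)" for i w
  have t_sum: "summable (\<lambda>i. t i w)" for w
    unfolding t_def
    by (intro summable_add summable_mult summable_overlap
        summable_comparison_test'[OF summable_cost', of 0]) (auto simp: cost_nonneg)
  have len: "length (u @ v) = n" "set (u @ v) \<subseteq> {1..L}" if "v \<in> V" for v
    using that n u by (auto simp: V_def words_def)
  have t_nonneg: "0 \<le> t i w" for i w
    using cost_nonneg[of i] by (simp add: t_def overlap_nonneg)
  have upper: "(\<Sum>v\<in>V. \<Sum>i. t i (u @ v)) < (1 / L) ^ length u"
  proof -
    have "(\<Sum>v\<in>V. \<Sum>i. t i (u @ v)) = (\<Sum>i. \<Sum>v\<in>V. t i (u @ v))"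
      by (rule suminf_sum[symmetric]) (rule t_sum)
    also have "\<dots> \<le> (\<Sum>i. (if i \<in> I then overlap L (c i) u else 0) +
        2 * L * (if n \<le> length (c i) then cost i else 0))"
    proof (rule suminf_le)
      fix i
      have 1: "(\<Sum>v\<in>V. if i \<in> I then overlap L (c i) (u @ v) else 0) =
          (if i \<in> I then overlap L (c i) u else 0)"
        using sum_overlap_words[OF alphabet] L by (auto simp: V_def)
      \<comment> \<open>At most one word of length \<open>n\<close> is a prefix of \<open>c i\<close>, so no cost is counted twice.\<close>
      have "(\<Sum>v\<in>V. if n \<le> length (c i) \<and> prefix (u @ v) (c i) then cost i else 0) \<le>
          (\<Sum>v\<in>V. if v = drop (length u) (take n (c i)) then
             (if n \<le> length (c i) then cost i else 0) else 0)"
      proof (rule sum_mono)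
        fix v assume "v \<in> V"
        then have "v = drop (length u) (take n (c i))" if "prefix (u @ v) (c i)"
          using that len(1)[of v] by (auto simp: prefix_def)
        then show "(if n \<le> length (c i) \<and> prefix (u @ v) (c i) then cost i else 0) \<le>
          (if v = drop (length u) (take n (c i)) then
             (if n \<le> length (c i) then cost i else 0) else 0)"
          by (auto simp: cost_nonneg)
      qed
      also have "\<dots> \<le> (if n \<le> length (c i) then cost i else 0)"
        by (subst sum.delta) (auto simp: V_def finite_words cost_nonneg)
      finally have 2: "2 * L * (\<Sum>v\<in>V. if n \<le> length (c i) \<and> prefix (u @ v) (c i) then cost i else 0)
        \<le> 2 * L * (if n \<le> length (c i) then cost i else 0)"
        by (intro mult_left_mono) auto
      show "(\<Sum>v\<in>V. t i (u @ v)) \<le> (if i \<in> I then overlap L (c i) u else 0) +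
        2 * L * (if n \<le> length (c i) then cost i else 0)"
        unfolding t_def sum.distrib 1 using 2 by (simp add: sum_distrib_left)
    next
      show "summable (\<lambda>i. \<Sum>v\<in>V. t i (u @ v))" by (intro summable_sum t_sum)
      show "summable (\<lambda>i. (if i \<in> I then overlap L (c i) u else 0) +
        2 * L * (if n \<le> length (c i) then cost i else 0))"
        by (intro summable_add summable_mult summable_overlap
          summable_comparison_test'[OF summable_cost', of 0]) (auto simp: cost_nonneg)
    qed
    also have "\<dots> = covered u + 2 * L * (\<Sum>i. if n \<le> length (c i) then cost i else 0)"
    proof -
      have s: "summable (\<lambda>i. if n \<le> length (c i) then cost i else 0)"
        by (rule summable_comparison_test'[OF summable_cost', of 0]) (auto simp: cost_nonneg)
      show ?thesis unfolding covered_def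
        by (simp add: suminf_add[OF summable_overlap summable_mult[OF s], symmetric] suminf_mult[OF s])
    qed
    also have "\<dots> < (1 / L) ^ length u"
      using half tail L by (simp add: field_simps)
    finally show ?thesis .
  qed
  have lower: "(1 / L) ^ n \<le> (\<Sum>i. t i w)"
    if w: "length w = n" and bad: "(1 / L) ^ (n + m) / 2 < covered (periodic_ext w m)" for w
  proof (cases "\<exists>i\<in>I. prefix (c i) w")
    case True
    then obtain i where i: "i \<in> I" "prefix (c i) w" by blast
    have "(1 / L) ^ n \<le> t i w"
      using i w cost_nonneg[of i] by (auto simp: t_def overlap_prefix)
    also have "\<dots> \<le> (\<Sum>i. t i w)"
      using sum_le_suminf[OF t_sum, of "{i}" w] t_nonneg by simp
    finally show ?thesis .
  next
    case False
    define q where "q = (1 / L) powr ((n + m) * b / (1 + b))"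
    have q: "0 < q" using L by (simp add: q_def)
    have "(if i \<in> I then overlap L (c i) (periodic_ext w m) else 0) \<le> q / (2 * L) * t i w" for i
    proof (cases "i \<in> I \<and> overlap L (c i) (periodic_ext w m) \<noteq> 0")
      case T: True
      then have "prefix (c i) (periodic_ext w m) \<or> prefix (periodic_ext w m) (c i)"
        by (auto simp: overlap_def split: if_splits)
      then have pw: "prefix w (c i)"
        using False T prefix_periodic_ext[of w m]
        by (meson prefix_order.trans prefix_same_cases)
      have "overlap L (c i) (periodic_ext w m) \<le> q * cost i"
        using overlap_le_cost[of i "periodic_ext w m"] T w by (simp add: q_def)
      also have "\<dots> = q / (2 * L) * (2 * L * cost i)" using L by simp
      also have "\<dots> \<le> q / (2 * L) * t i w"
        using T pw w q prefix_length_le[OF pw]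
        by (intro mult_left_mono) (auto simp: t_def overlap_nonneg)
      finally show ?thesis using T by simp
    next
      case F: False
      then show ?thesis using q t_nonneg[of i w] by auto
    qed
    then have "covered (periodic_ext w m) \<le> (\<Sum>i. q / (2 * L) * t i w)"
      unfolding covered_def by (intro suminf_le summable_overlap summable_mult t_sum) auto
    also have "\<dots> = q / (2 * L) * (\<Sum>i. t i w)" by (rule suminf_mult[OF t_sum])
    finally have "(1 / L) ^ (n + m) < 2 * (q / (2 * L) * (\<Sum>i. t i w))" using bad by linarith
    then have "(1 / L) ^ (n + m) < q / L * (\<Sum>i. t i w)" by simp
    moreover have "q * (1 / L) ^ Suc n \<le> (1 / L) ^ (n + m)"
    proof -
      have "real m \<le> b * n + 1" using b by (simp add: m_def)
      then have "real (n + m) \<le> (n + m) * b / (1 + b) + real (Suc n)"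
        using b by (simp add: field_simps)
      then have "(1 / L) powr ((n + m) * b / (1 + b) + real (Suc n)) \<le> (1 / L) powr real (n + m)"
        using L by (intro powr_mono') auto
      then show ?thesis unfolding powr_add q_def by (simp only: powr_inverse_size)
    qed
    ultimately have "q * (1 / L) ^ Suc n < q / L * (\<Sum>i. t i w)" by linarith
    then show ?thesis using q L by (simp add: field_simps)
  qed
  have "\<exists>v\<in>V. covered (periodic_ext (u @ v) m) \<le> (1 / L) ^ (n + m) / 2"
  proof (rule ccontr)
    assume "\<not> ?thesis"
    then have "(\<Sum>v\<in>V. (1 / real L) ^ n) \<le> (\<Sum>v\<in>V. \<Sum>i. t i (u @ v))"
      by (intro sum_mono lower len) auto
    moreover have "(\<Sum>v\<in>V. (1 / real L) ^ n) = (1 / L) ^ length u"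
    proof -
      have "n = length u + (n - length u)" using n by simp
      then have "(1 / real L) ^ n = (1 / L) ^ length u * (1 / L) ^ (n - length u)"
        by (metis power_add)
      then show ?thesis using L by (simp add: V_def card_words field_simps)
    qed
    ultimately show False using upper by simp
  qed
  then obtain v where v: "v \<in> V" "covered (periodic_ext (u @ v) m) \<le> (1 / L) ^ (n + m) / 2"
    by blast
  show ?thesis
  proof (rule that)
    show "set (u @ v) \<subseteq> {1..L}" using len v by simp
    have "v \<noteq> []" using len(1)[OF v(1)] n by auto
    then show "strict_prefix u (u @ v)" by (simp add: strict_prefix_def)
    show "covered (periodic_ext (u @ v) (nat \<lfloor>b * length (u @ v)\<rfloor> + 1)) \<le>
      (1 / L) ^ length (periodic_ext (u @ v) (nat \<lfloor>b * length (u @ v)\<rfloor> + 1)) / 2"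
      using v(2) unfolding length_periodic_ext len(1)[OF v(1)] m_def .
  qed
qed

text \<open>Iterating the step gives nested words, each of them half free, and the limit sequence.  If one of
the covering words were a prefix of the limit, it would eventually be a prefix of a word of the
construction and cover that word entirely, which contradicts half freeness.\<close>
lemma recurrent_sequence_avoiding_words:
  assumes small: "(\<Sum>i. if i \<in> I then (1 / L) ^ length (c i) else 0) \<le> (1 / 2 :: real)"
  obtains e where "e \<in> symbol_space L"
    "infinite {n. 1 \<le> n \<and> (\<forall>k \<le> nat \<lfloor>b * n\<rfloor>. e (k + n) = e k)}"
    "\<forall>i\<in>I. map e [0..<length (c i)] \<noteq> c i"
proof -
  define good where "good u \<longleftrightarrow> set u \<subseteq> {1..L} \<and> covered u \<le> (1 / L) ^ length u / 2" for u
  define step where "step u u' \<longleftrightarrow> (\<exists>w. strict_prefix u w \<and>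
     u' = periodic_ext w (nat \<lfloor>b * length w\<rfloor> + 1))" for u u'
  have "\<exists>U. \<forall>k. good (U k) \<and> step (U k) (U (Suc k))"
  proof (rule dependent_nat_choice)
    have "overlap L (c i) [] = (1 / L) ^ length (c i)" for i
      by (simp add: overlap_def)
    then have "good []" using small by (simp add: good_def covered_def cong: if_cong)
    then show "\<exists>u. good u" ..
    fix u assume "good u"
    then obtain w where w: "set w \<subseteq> {1..L}" "strict_prefix u w"
      "covered (periodic_ext w (nat \<lfloor>b * length w\<rfloor> + 1)) \<le>
        (1 / L) ^ length (periodic_ext w (nat \<lfloor>b * length w\<rfloor> + 1)) / 2"
      unfolding good_def using extend_half_free by blast
    then have "w \<noteq> []" by auto
    then show "\<exists>u'. good u' \<and> step u u'"
      using w set_periodic_ext unfolding good_def step_def by blast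
  qed
  then obtain U where good: "\<And>k. good (U k)" and step: "\<And>k. step (U k) (U (Suc k))" by blast
  have chain: "strict_prefix (U k) (U (Suc k))" for k
    using step[of k] prefix_periodic_ext unfolding step_def
    by (metis prefix_order.less_le_trans)
  have mono: "prefix (U k) (U l)" if "k \<le> l" for k l
    using that by (induction rule: dec_induct) (use chain prefix_order.less_imp_le prefix_order.trans in blast)+
  have grow: "k \<le> length (U k)" for k
  proof (induction k)
    case (Suc k)
    then show ?case using prefix_length_less[OF chain[of k]] by simp
  qed simp
  define e where "e i = U (Suc i) ! i" for i
  have e: "e i = U k ! i" if "i < length (U k)" for i k
  proof (cases "k \<le> Suc i")
    case True
    then show ?thesis using mono[of k "Suc i"] that by (auto simp: e_def prefix_def nth_append)
  next
    case False
    then show ?thesis using mono[of "Suc i" k] grow[of "Suc i"] by (auto simp: e_def prefix_def nth_append)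
  qed
  show ?thesis
  proof (rule that)
    show "e \<in> symbol_space L"
      using good grow unfolding symbol_space_def good_def e_def
      by (smt (verit, best) Suc_le_lessD mem_Collect_eq nth_mem subsetD)
    show "infinite {n. 1 \<le> n \<and> (\<forall>k \<le> nat \<lfloor>b * n\<rfloor>. e (k + n) = e k)}"
      unfolding infinite_nat_iff_unbounded_le
    proof
      fix k
      obtain w where w: "strict_prefix (U k) w" "U (Suc k) = periodic_ext w (nat \<lfloor>b * length w\<rfloor> + 1)"
        using step[of k] unfolding step_def by blast
      have "k < length w" using grow[of k] prefix_length_less[OF w(1)] by simp
      moreover have "e (j + length w) = e j" if "j \<le> nat \<lfloor>b * length w\<rfloor>" for j
        using e[of j "Suc k"] e[of "j + length w" "Suc k"] that nth_periodic_ext[of j _ w]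
        unfolding w(2) by simp
      ultimately show "\<exists>n\<ge>k. n \<in> {n. 1 \<le> n \<and> (\<forall>k \<le> nat \<lfloor>b * n\<rfloor>. e (k + n) = e k)}"
        by (intro exI[of _ "length w"]) auto
    qed
    show "\<forall>i\<in>I. map e [0..<length (c i)] \<noteq> c i"
    proof (intro ballI notI)
      fix i assume i: "i \<in> I" and eq: "map e [0..<length (c i)] = c i"
      let ?k = "length (c i)"
      have "take ?k (U ?k) = c i"
        using grow[of ?k] e[of _ ?k] by (subst eq[symmetric]) (intro nth_equalityI, auto)
      then have "prefix (c i) (U ?k)" by (metis take_is_prefix)
      then have "(1 / L) ^ length (U ?k) \<le> covered (U ?k)"
        using overlap_le_covered[OF i, of "U ?k"] by (simp add: overlap_prefix)
      then show False using good[of ?k] L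
        by (smt (verit) field_sum_of_halves good_def of_nat_0_less_iff pos2 zero_less_divide_iff
            zero_less_power order_less_le_trans)
    qed
  qed
qed

end

section \<open>Hausdorff measures\<close>

lemma hausdorff_premeasure_le_measure:
  assumes "0 < \<tau>"
  shows "hausdorff_premeasure f X \<tau> F \<le> hausdorff_measure f X F"
proof (rule tendsto_lowerbound[OF hausdorff_premeasure_tendsto])
  show "\<forall>\<^sub>F \<tau>' in at_right 0. hausdorff_premeasure f X \<tau> F \<le> hausdorff_premeasure f X \<tau>' F"
    using assms unfolding eventually_at_right_field
    by (intro exI[of _ \<tau>]) (auto intro: hausdorff_premeasure_antimono)
qed simp

lemma hausdorff_measure_le:
  assumes "\<And>\<tau>. 0 < \<tau> \<Longrightarrow> hausdorff_premeasure f X \<tau> F \<le> C"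
  shows "hausdorff_measure f X F \<le> C"
proof (rule tendsto_upperbound[OF hausdorff_premeasure_tendsto])
  show "\<forall>\<^sub>F \<tau> in at_right 0. hausdorff_premeasure f X \<tau> F \<le> C"
    using assms unfolding eventually_at_right_field by (intro exI[of _ 1]) auto
qed simp

lemma hausdorff_measure_mono:
  assumes "F \<subseteq> G"
  shows "hausdorff_measure f X F \<le> hausdorff_measure f X G"
proof (rule hausdorff_measure_le)
  fix \<tau> :: real assume "0 < \<tau>"
  have "hausdorff_premeasure f X \<tau> F \<le> hausdorff_premeasure f X \<tau> G"
    unfolding hausdorff_premeasure_def
    by (rule Inf_superset_mono) (use assms in \<open>unfold ball_cover_def, blast\<close>)
  also have "\<dots> \<le> hausdorff_measure f X G"
    by (rule hausdorff_premeasure_le_measure) fact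
  finally show "hausdorff_premeasure f X \<tau> F \<le> hausdorff_measure f X G" .
qed

lemma hausdorff_premeasure_le_cover:
  assumes "ball_cover X \<tau> F I x r"
  shows "hausdorff_premeasure f X \<tau> F \<le> (\<Sum>i. if i \<in> I then ennreal (f (2 * r i)) else 0)"
  unfolding hausdorff_premeasure_def
  using assms by (intro Inf_lower) blast

text \<open>The convergence part of the Borel--Cantelli principle for Hausdorff measures: the balls of all
levels from \<open>N\<close> on cover \<open>F\<close>, and their cost is a tail of a convergent series.\<close>
lemma hausdorff_measure_limsup_eq_0:
  fixes P :: "nat \<Rightarrow> 'a::metric_space set"
  assumes P: "\<And>n. finite (P n)" "\<And>n. P n \<subseteq> X"
    and r: "filterlim r (at_right 0) sequentially"
    and f: "\<And>t. 0 \<le> f t"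
    and sum: "summable (\<lambda>n. real (card (P n)) * f (2 * r n))"
    and F: "F \<subseteq> X" "\<And>x. x \<in> F \<Longrightarrow> infinite {n. \<exists>p\<in>P n. dist p x < r n}"
  shows "hausdorff_measure f X F = 0"
proof -
  have *: "hausdorff_premeasure f X \<tau> F \<le> ennreal \<epsilon>" if \<tau>: "0 < \<tau>" and \<epsilon>: "0 < \<epsilon>" for \<tau> \<epsilon>
  proof -
    have "\<forall>\<^sub>F n in sequentially. r n \<in> {0<..\<tau>}"
      using eventually_compose_filterlim[OF eventually_at_right_real[OF \<tau>] r]
      by (rule eventually_mono) auto
    then obtain N1 where N1: "\<And>n. n \<ge> N1 \<Longrightarrow> r n \<in> {0<..\<tau>}"
      unfolding eventually_sequentially by blast
    let ?a = "\<lambda>n. real (card (P n)) * f (2 * r n)"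
    obtain N where N: "N1 \<le> N" "(\<Sum>n. if N \<le> n then ?a n else 0) < \<epsilon>"
      using suminf_tail_le[OF sum _ \<epsilon>, of N1 "\<lambda>n. n"] f by auto
    have sum': "summable (\<lambda>n. if N \<le> n then ?a n else 0)"
      by (rule summable_comparison_test'[OF sum, of 0]) (auto simp: f)
    obtain h where h: "\<And>n. bij_betw (h n) {..<card (P n)} (P n)"
      using ex_bij_betw_nat_finite[OF P(1)] by (metis atLeast0LessThan)
    \<comment> \<open>The balls of the tail are indexed by pairs, which are encoded as natural numbers.\<close>
    define J where "J = {(n, k). N \<le> n \<and> k < card (P n)}"
    define v where "v p = (if p \<in> J then ennreal (f (2 * r (fst p))) else 0)" for p
    define I where "I = prod_decode -` J"
    have "ball_cover X \<tau> F I (\<lambda>i. case_prod h (prod_decode i)) (\<lambda>i. r (fst (prod_decode i)))"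
      unfolding ball_cover_def
    proof (intro conjI ballI subsetI)
      fix i assume "i \<in> I"
      then obtain n k where nk: "prod_decode i = (n, k)" "N \<le> n" "k < card (P n)"
        by (auto simp: I_def J_def)
      then show "case_prod h (prod_decode i) \<in> X" "0 < r (fst (prod_decode i))"
        "r (fst (prod_decode i)) \<le> \<tau>"
        using N1[of n] N(1) P(2) bij_betwE[OF h[of n]] by auto
    next
      fix x assume x: "x \<in> F"
      then obtain n p where n: "N \<le> n" "p \<in> P n" "dist p x < r n"
        using F(2) unfolding infinite_nat_iff_unbounded_le by blast
      obtain k where k: "k < card (P n)" "h n k = p"
        using n(2) h[of n] unfolding bij_betw_def by (metis imageE lessThan_iff)
      have "prod_encode (n, k) \<in> I" using n k by (simp add: I_def J_def)
      then show "x \<in> (\<Union>i\<in>I. ball (case_prod h (prod_decode i)) (r (fst (prod_decode i))) \<inter> X)"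
        using n k x F(1) by (intro UN_I[of "prod_encode (n, k)"]) auto
    qed
    from hausdorff_premeasure_le_cover[OF this, of f]
    have "hausdorff_premeasure f X \<tau> F \<le>
        (\<Sum>i. if i \<in> I then ennreal (f (2 * r (fst (prod_decode i)))) else 0)"
      .
    also have "\<dots> = (\<Sum>i. v (prod_decode i))"
      by (rule suminf_cong) (simp add: I_def v_def split_beta)
    also have "\<dots> = (\<Sum>n. ennreal (if N \<le> n then ?a n else 0))"
    proof (rule suminf_ennreal_2dimen[of _ v])
      fix n
      have "(\<Sum>k. v (n, k)) = (\<Sum>k<card (P n). v (n, k))"
        by (rule suminf_finite) (auto simp: J_def v_def)
      also have "\<dots> = ennreal (if N \<le> n then ?a n else 0)"
        using f by (auto simp: J_def v_def ennreal_mult) (simp only: ennreal_of_nat_eq_real_of_nat)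
      finally show "ennreal (if N \<le> n then ?a n else 0) = (\<Sum>k. v (n, k))" by simp
    qed
    also have "\<dots> = ennreal (\<Sum>n. if N \<le> n then ?a n else 0)"
      by (rule suminf_ennreal2[OF _ sum']) (simp add: f)
    also have "\<dots> \<le> ennreal \<epsilon>" by (rule ennreal_leI[OF less_imp_le[OF N(2)]])
    finally show ?thesis .
  qed
  have "hausdorff_premeasure f X \<tau> F \<le> 0" if "0 < \<tau>" for \<tau>
    by (rule ennreal_le_epsilon) (simp add: * that)
  then have "hausdorff_measure f X F \<le> 0" by (rule hausdorff_measure_le)
  then show ?thesis by simp
qed

section \<open>Coding of the attractor\<close>

locale separated_ifs =
  fixes L :: nat and \<rho> :: real and a :: "nat \<Rightarrow> real" and K :: "real set"
  assumes L: "2 \<le> L" and \<rho>: "0 < \<rho>" "\<rho> < 1"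
    and offset: "\<And>j. j \<in> {1..L} \<Longrightarrow> 0 \<le> a j \<and> a j \<le> 1 - \<rho>"
    and attractor: "is_attractor L \<rho> a K"
    and separation: "strong_separation L \<rho> a K"
begin

definition point :: "(nat \<Rightarrow> nat) \<Rightarrow> real" where
  "point e = (\<Sum>k. \<rho> ^ k * a (e k))"

lemma symbol_space_shift: "e \<in> symbol_space L \<Longrightarrow> (\<lambda>k. e (k + n)) \<in> symbol_space L"
  by (simp add: symbol_space_def)

lemma summable_point: "e \<in> symbol_space L \<Longrightarrow> summable (\<lambda>k. \<rho> ^ k * a (e k))"
  by (rule summable_comparison_test'[OF summable_mult2[OF summable_geometric, of \<rho> "1 - \<rho>"], of 0])
     (use \<rho> offset in \<open>auto simp: symbol_space_def abs_mult intro!: mult_mono\<close>)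

lemma point_bounds:
  assumes "e \<in> symbol_space L" shows "0 \<le> point e" "point e \<le> 1"
proof -
  show "0 \<le> point e" unfolding point_def
    using assms \<rho> offset by (intro suminf_nonneg summable_point) (auto simp: symbol_space_def)
  have "point e \<le> (\<Sum>k. \<rho> ^ k * (1 - \<rho>))" unfolding point_def
    using assms \<rho> offset
    by (intro suminf_le summable_point summable_mult2 summable_geometric)
       (auto simp: symbol_space_def intro!: mult_left_mono)
  also have "\<dots> = 1" using \<rho> by (simp add: suminf_mult2[symmetric] suminf_geometric)
  finally show "point e \<le> 1" .
qed

lemma point_split:
  assumes "e \<in> symbol_space L"
  shows "point e = (\<Sum>k<n. \<rho> ^ k * a (e k)) + \<rho> ^ n * point (\<lambda>k. e (k + n))"
proof -
  have "point e = (\<Sum>k. \<rho> ^ (k + n) * a (e (k + n))) + (\<Sum>k<n. \<rho> ^ k * a (e k))"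
    unfolding point_def by (rule suminf_split_initial_segment[OF summable_point[OF assms]])
  also have "(\<Sum>k. \<rho> ^ (k + n) * a (e (k + n))) = \<rho> ^ n * point (\<lambda>k. e (k + n))"
    unfolding point_def
    by (subst suminf_mult[OF summable_point[OF symbol_space_shift[OF assms]], symmetric])
       (simp add: power_add mult_ac)
  finally show ?thesis by simp
qed

lemma cylinder_map_eq: "cylinder_map \<rho> a e n x = (\<Sum>k<n. \<rho> ^ k * a (e k)) + \<rho> ^ n * x"
  by (induction n arbitrary: x) (simp_all add: ifs_map_def algebra_simps)

lemma dist_point_le:
  assumes "e \<in> symbol_space L" "e' \<in> symbol_space L" "\<And>k. k < n \<Longrightarrow> e k = e' k"
  shows "\<bar>point e - point e'\<bar> \<le> \<rho> ^ n"
proof -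
  have "point e - point e' = \<rho> ^ n * (point (\<lambda>k. e (k + n)) - point (\<lambda>k. e' (k + n)))"
    using point_split[OF assms(1), of n] point_split[OF assms(2), of n] assms(3)
    by (simp add: algebra_simps)
  moreover have "\<bar>point (\<lambda>k. e (k + n)) - point (\<lambda>k. e' (k + n))\<bar> \<le> 1"
    using point_bounds[OF symbol_space_shift[OF assms(1), of n]]
      point_bounds[OF symbol_space_shift[OF assms(2), of n]] by linarith
  ultimately show ?thesis using \<rho> by (simp add: abs_mult mult_left_le)
qed

lemma \<rho>_powers: "(\<lambda>n. \<rho> ^ n) \<longlonglongrightarrow> 0"
  using \<rho> by (intro LIMSEQ_realpow_zero) auto

lemma point_in_cylinder:
  assumes "e \<in> symbol_space L" shows "point e \<in> cylinder_map \<rho> a e n ` {0..1}"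
proof (rule image_eqI)
  show "point e = cylinder_map \<rho> a e n (point (\<lambda>k. e (k + n)))"
    unfolding cylinder_map_eq by (rule point_split[OF assms])
qed (simp add: point_bounds symbol_space_shift[OF assms])

text \<open>The \<open>n\<close>-th cylinder has diameter at most \<open>\<rho> ^ n\<close>, so the intersection is a single point.\<close>
lemma eq_point_if_in_cylinders:
  assumes e: "e \<in> symbol_space L" and x: "\<And>n. 1 \<le> n \<Longrightarrow> x \<in> cylinder_map \<rho> a e n ` {0..1}"
  shows "x = point e"
proof -
  have "\<bar>x - point e\<bar> \<le> \<rho> ^ n" if n: "1 \<le> n" for n
  proof -
    obtain y where y: "y \<in> {0..1}" "x = cylinder_map \<rho> a e n y" using x[OF n] by blast
    have "x - point e = \<rho> ^ n * (y - point (\<lambda>k. e (k + n)))"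
      using point_split[OF e, of n] y by (simp add: cylinder_map_eq algebra_simps)
    moreover have "\<bar>y - point (\<lambda>k. e (k + n))\<bar> \<le> 1"
      using point_bounds[OF symbol_space_shift[OF e, of n]] y by (auto simp: abs_le_iff)
    ultimately show ?thesis using \<rho> by (simp add: abs_mult mult_left_le)
  qed
  then have "\<bar>x - point e\<bar> \<le> 0"
    by (intro LIMSEQ_le_const[OF \<rho>_powers]) blast
  then show "x = point e" by simp
qed

lemma coding_map_eq:
  assumes "e \<in> symbol_space L"
  shows "coding_map \<rho> a e = point e"
  unfolding coding_map_def
  by (rule the_equality)
     (use point_in_cylinder[OF assms] eq_point_if_in_cylinders[OF assms] in auto)

lemma compact_K: "compact K" and K_nonempty: "K \<noteq> {}" and K_unit: "K \<subseteq> {0..1}"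
  and K_eq: "K = (\<Union>j\<in>{1..L}. ifs_map \<rho> a j ` K)"
  using attractor unfolding is_attractor_def by auto

lemma ifs_map_in_K: "j \<in> {1..L} \<Longrightarrow> x \<in> K \<Longrightarrow> ifs_map \<rho> a j x \<in> K"
  using equalityD2[OF K_eq] by blast

lemma K_cases:
  assumes "x \<in> K" obtains j y where "j \<in> {1..L}" "y \<in> K" "x = ifs_map \<rho> a j y"
  using subsetD[OF equalityD1[OF K_eq] assms] by blast

lemma cylinder_map_in_K:
  "e \<in> symbol_space L \<Longrightarrow> x \<in> K \<Longrightarrow> cylinder_map \<rho> a e n x \<in> K"
  by (induction n arbitrary: x) (simp_all add: symbol_space_def ifs_map_in_K)

text \<open>The point is the limit of the images of an arbitrary point of \<open>K\<close> under the cylinder maps, and \<open>K\<close>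
is closed and invariant.\<close>
lemma point_in_K:
  assumes e: "e \<in> symbol_space L" shows "point e \<in> K"
proof -
  obtain y where y: "y \<in> K" using K_nonempty by blast
  have "(\<lambda>n. (\<Sum>k<n. \<rho> ^ k * a (e k)) + \<rho> ^ n * y) \<longlonglongrightarrow> point e + 0 * y"
    unfolding point_def
    by (intro tendsto_intros summable_LIMSEQ summable_point e \<rho>_powers)
  then have "(\<lambda>n. cylinder_map \<rho> a e n y) \<longlonglongrightarrow> point e"
    by (simp add: cylinder_map_eq)
  then show ?thesis
    using closed_sequentially[OF compact_imp_closed[OF compact_K],
        of "\<lambda>n. cylinder_map \<rho> a e n y" "point e"] cylinder_map_in_K[OF e y] by simp
qed

text \<open>Self-similarity lets one choose, again and again, a symbol and a preimage in \<open>K\<close>; \<open>s n\<close> below is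
the pair of the \<open>n\<close>-th preimage and the \<open>n\<close>-th symbol.\<close>
lemma K_coded:
  assumes x: "x \<in> K" obtains e where "e \<in> symbol_space L" "x = point e"
proof -
  have "\<exists>s. \<forall>n. (fst (s n) \<in> K \<and> snd (s n) \<in> {1..L} \<and> (n = 0 \<longrightarrow> x = ifs_map \<rho> a (snd (s n)) (fst (s n)))) \<and>
     fst (s n) = ifs_map \<rho> a (snd (s (Suc n))) (fst (s (Suc n)))"
  proof (rule dependent_nat_choice)
    show "\<exists>p. fst p \<in> K \<and> snd p \<in> {1..L} \<and> ((0::nat) = 0 \<longrightarrow> x = ifs_map \<rho> a (snd p) (fst p))"
      by (rule K_cases[OF x]) auto
    fix p and n :: nat
    assume "fst p \<in> K \<and> snd p \<in> {1..L} \<and> (n = 0 \<longrightarrow> x = ifs_map \<rho> a (snd p) (fst p))"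
    then have "fst p \<in> K" by blast
    then obtain j y where "j \<in> {1..L}" "y \<in> K" "fst p = ifs_map \<rho> a j y"
      by (rule K_cases)
    then show "\<exists>q. (fst q \<in> K \<and> snd q \<in> {1..L} \<and> (Suc n = 0 \<longrightarrow> x = ifs_map \<rho> a (snd q) (fst q))) \<and>
        fst p = ifs_map \<rho> a (snd q) (fst q)" by auto
  qed
  then obtain s where s': "\<forall>n. (fst (s n) \<in> K \<and> snd (s n) \<in> {1..L} \<and> (n = 0 \<longrightarrow> x = ifs_map \<rho> a (snd (s n)) (fst (s n)))) \<and>
     fst (s n) = ifs_map \<rho> a (snd (s (Suc n))) (fst (s (Suc n)))" ..
  have s: "fst (s n) \<in> K" "snd (s n) \<in> {1..L}"
    "fst (s n) = ifs_map \<rho> a (snd (s (Suc n))) (fst (s (Suc n)))" for n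
  proof -
    show "fst (s n) \<in> K" using spec[OF s', of n] by (elim conjE)
    show "snd (s n) \<in> {1..L}" using spec[OF s', of n] by (elim conjE)
    show "fst (s n) = ifs_map \<rho> a (snd (s (Suc n))) (fst (s (Suc n)))"
      using spec[OF s', of n] by (elim conjE)
  qed
  have s0: "x = ifs_map \<rho> a (snd (s 0)) (fst (s 0))"
    using spec[OF s', of 0] by simp
  define e where "e = snd \<circ> s"
  have e: "e \<in> symbol_space L" using s(2) by (simp add: e_def symbol_space_def)
  have "x = cylinder_map \<rho> a e (Suc n) (fst (s n))" for n
  proof (induction n)
    case 0
    then show ?case using s0 by (simp add: e_def)
  next
    case (Suc n)
    then show ?case using s(3)[of n] by (simp add: e_def)
  qed
  then have "x \<in> cylinder_map \<rho> a e (Suc n) ` {0..1}" for n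
    using s(1)[of n] K_unit by (intro image_eqI[where x = "fst (s n)"]) auto
  then have "x \<in> cylinder_map \<rho> a e n ` {0..1}" if "1 \<le> n" for n
    using that by (cases n) auto
  then show ?thesis using that e eq_point_if_in_cylinders[OF e] by blast
qed

lemma gap_exists:
  "\<exists>\<delta>>0. \<forall>i\<in>{1..L}. \<forall>j\<in>{1..L}. \<forall>x\<in>K. \<forall>y\<in>K. i \<noteq> j \<longrightarrow>
     \<delta> \<le> \<bar>ifs_map \<rho> a i x - ifs_map \<rho> a j y\<bar>"
proof -
  let ?R = "{p \<in> {1..L} \<times> {1..L}. fst p \<noteq> snd p}"
  have sep: "\<exists>d>0. \<forall>x\<in>ifs_map \<rho> a i ` K. \<forall>y\<in>ifs_map \<rho> a j ` K. d \<le> dist x y"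
    if "i \<in> {1..L}" "j \<in> {1..L}" "i \<noteq> j" for i j
  proof (rule separate_compact_closed)
    have "compact (ifs_map \<rho> a i ` K)" for i
      unfolding ifs_map_def by (intro compact_continuous_image continuous_intros compact_K)
    then show "compact (ifs_map \<rho> a i ` K)" "closed (ifs_map \<rho> a j ` K)"
      by (auto intro: compact_imp_closed)
    show "ifs_map \<rho> a i ` K \<inter> ifs_map \<rho> a j ` K = {}"
      using separation that unfolding strong_separation_def disjoint_family_on_def by blast
  qed
  have "\<exists>d>0. \<forall>x\<in>K. \<forall>y\<in>K. d \<le> \<bar>ifs_map \<rho> a i x - ifs_map \<rho> a j y\<bar>"
    if "i \<in> {1..L}" "j \<in> {1..L}" "i \<noteq> j" for i j
    using sep[OF that] by (simp add: dist_real_def)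
  then have "\<forall>p\<in>?R. \<exists>d>0. \<forall>x\<in>K. \<forall>y\<in>K. d \<le> \<bar>ifs_map \<rho> a (fst p) x - ifs_map \<rho> a (snd p) y\<bar>"
    by simp
  from bchoice[OF this] obtain d where d': "\<forall>p\<in>?R. 0 < d p \<and>
      (\<forall>x\<in>K. \<forall>y\<in>K. d p \<le> \<bar>ifs_map \<rho> a (fst p) x - ifs_map \<rho> a (snd p) y\<bar>)"
    by blast
  then have d: "\<And>p. p \<in> ?R \<Longrightarrow> 0 < d p"
    "\<And>p x y. p \<in> ?R \<Longrightarrow> x \<in> K \<Longrightarrow> y \<in> K \<Longrightarrow>
       d p \<le> \<bar>ifs_map \<rho> a (fst p) x - ifs_map \<rho> a (snd p) y\<bar>"
    by blast+
  have fin: "finite (insert 1 (d ` ?R))" by simp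
  have pos: "0 < Min (insert 1 (d ` ?R))" using d(1) by (subst Min_gr_iff[OF fin]) auto
  have "Min (insert 1 (d ` ?R)) \<le> \<bar>ifs_map \<rho> a i x - ifs_map \<rho> a j y\<bar>"
    if ij: "i \<in> {1..L}" "j \<in> {1..L}" "i \<noteq> j" and xy: "x \<in> K" "y \<in> K" for i j x y
  proof -
    have "Min (insert 1 (d ` ?R)) \<le> d (i, j)" using ij by (intro Min_le[OF fin]) auto
    also have "\<dots> \<le> \<bar>ifs_map \<rho> a i x - ifs_map \<rho> a j y\<bar>" using d(2)[of "(i, j)" x y] ij xy by simp
    finally show ?thesis .
  qed
  with pos show ?thesis by (intro exI[of _ "Min (insert 1 (d ` ?R))"]) blast
qed

definition gap :: real where
  "gap = (SOME \<delta>. 0 < \<delta> \<and> (\<forall>i\<in>{1..L}. \<forall>j\<in>{1..L}. \<forall>x\<in>K. \<forall>y\<in>K. i \<noteq> j \<longrightarrow>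
       \<delta> \<le> \<bar>ifs_map \<rho> a i x - ifs_map \<rho> a j y\<bar>))"

lemma gap: "0 < gap"
  "\<lbrakk>i \<in> {1..L}; j \<in> {1..L}; i \<noteq> j; x \<in> K; y \<in> K\<rbrakk> \<Longrightarrow> gap \<le> \<bar>ifs_map \<rho> a i x - ifs_map \<rho> a j y\<bar>"
proof -
  have "\<exists>\<delta>. 0 < \<delta> \<and> (\<forall>i\<in>{1..L}. \<forall>j\<in>{1..L}. \<forall>x\<in>K. \<forall>y\<in>K. i \<noteq> j \<longrightarrow>
       \<delta> \<le> \<bar>ifs_map \<rho> a i x - ifs_map \<rho> a j y\<bar>)"
    using gap_exists .
  from someI_ex[OF this]
  show "0 < gap"
    "\<lbrakk>i \<in> {1..L}; j \<in> {1..L}; i \<noteq> j; x \<in> K; y \<in> K\<rbrakk> \<Longrightarrow> gap \<le> \<bar>ifs_map \<rho> a i x - ifs_map \<rho> a j y\<bar>"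
    unfolding gap_def[symmetric] by blast+
qed

text \<open>The converse of \<open>dist_point_le\<close>, and the place where strong separation enters: at the first place
\<open>k\<close> where the codings differ, the two points are images, under the same similarity of ratio
\<open>\<rho> ^ k\<close>, of points in different first-level pieces.\<close>
lemma agree_if_close:
  assumes e: "e \<in> symbol_space L" "e' \<in> symbol_space L"
    and close: "\<bar>point e - point e'\<bar> < gap * \<rho> ^ n" and k: "k \<le> n"
  shows "e k = e' k"
  using k
proof (induction k rule: less_induct)
  case (less k)
  show ?case
  proof (rule ccontr)
    assume neq: "e k \<noteq> e' k"
    let ?s = "\<lambda>e i. e (i + k)"
    have one: "point (?s e) = ifs_map \<rho> a (e k) (point (\<lambda>i. e (i + Suc k)))"
      if "e \<in> symbol_space L" for e
      using point_split[OF symbol_space_shift[OF that], of k 1] by (simp add: ifs_map_def)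
    have "gap \<le> \<bar>point (?s e) - point (?s e')\<bar>"
      unfolding one[OF e(1)] one[OF e(2)]
      by (rule gap(2)) (use e neq in \<open>auto simp: symbol_space_def intro!: point_in_K\<close>)
    then have "gap * \<rho> ^ k \<le> \<rho> ^ k * \<bar>point (?s e) - point (?s e')\<bar>"
      using \<rho> by simp
    also have "\<dots> = \<bar>\<rho> ^ k * (point (?s e) - point (?s e'))\<bar>"
      using \<rho> by (simp add: abs_mult)
    also have "\<rho> ^ k * (point (?s e) - point (?s e')) = point e - point e'"
      using point_split[OF e(1), of k] point_split[OF e(2), of k] less
      by (simp add: algebra_simps)
    finally have "gap * \<rho> ^ k \<le> \<bar>point e - point e'\<bar>" .
    moreover have "gap * \<rho> ^ n \<le> gap * \<rho> ^ k"
      using less gap \<rho> by (intro mult_left_mono power_decreasing) auto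
    ultimately show False using close by linarith
  qed
qed

lemma inj_on_point: "inj_on point (symbol_space L)"
proof (rule inj_onI)
  fix e e' assume e: "e \<in> symbol_space L" "e' \<in> symbol_space L" "point e = point e'"
  have "e k = e' k" for k
    using e gap \<rho> by (intro agree_if_close[of e e' k]) auto
  then show "e = e'" by blast
qed

lemma coding_point:
  assumes "e \<in> symbol_space L" shows "coding L \<rho> a (point e) = e"
  unfolding coding_def
  by (rule the_equality) (use assms coding_map_eq inj_on_point in \<open>auto dest: inj_onD\<close>)

lemma shift_map_funpow:
  assumes "e \<in> symbol_space L"
  shows "(shift_map L \<rho> a ^^ n) (point e) = point (\<lambda>k. e (k + n))"
proof (induction n)
  case (Suc n)
  have "(\<lambda>k. e (Suc k + n)) \<in> symbol_space L" using assms by (simp add: symbol_space_def)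
  then show ?case
    using Suc coding_point[OF symbol_space_shift[OF assms, of n]]
    by (simp add: shift_map_def coding_map_eq)
qed simp

section \<open>Convergence: null recurrent sets\<close>

definition similarity_dim :: real where
  "similarity_dim = ln (real L) / (- ln \<rho>)"

lemma similarity_dim_pos: "0 < similarity_dim"
  using L \<rho> by (simp add: similarity_dim_def divide_pos_neg)

lemma \<rho>_powr_similarity_dim: "\<rho> powr similarity_dim = 1 / L"
  using L \<rho> by (simp add: similarity_dim_def powr_def exp_minus inverse_eq_divide)

text \<open>On the cylinder of a word of length \<open>n\<close> the \<open>n\<close>-th iterate \<open>y\<close> is an affine function of \<open>x\<close> with
slope \<open>1 / \<rho> ^ n\<close>.  Hence \<open>y - x\<close> has slope \<open>1 / \<rho> ^ n - 1 \<ge> (1 - \<rho>) / \<rho> ^ n\<close>, and any two of its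
points with \<open>\<bar>y - x\<bar> < t\<close> are closer than \<open>2 * \<rho> ^ n * t / (1 - \<rho>)\<close>.  One ball per word suffices, centred at any
such point.\<close>
lemma return_set_cover:
  assumes n: "1 \<le> n" and t: "0 < t"
  obtains P where "finite P" "P \<subseteq> K" "card P \<le> L ^ n"
    "\<And>x. \<lbrakk>x \<in> K; \<bar>(shift_map L \<rho> a ^^ n) x - x\<bar> < t\<rbrakk> \<Longrightarrow> \<exists>p\<in>P. dist p x < 2 * \<rho> ^ n * t / (1 - \<rho>)"
proof -
  define S where "S w = {e \<in> symbol_space L. map e [0..<n] = w \<and>
     \<bar>point (\<lambda>k. e (k + n)) - point e\<bar> < t}" for w
  have close: "\<bar>point e - point e'\<bar> < 2 * \<rho> ^ n * t / (1 - \<rho>)" if "e \<in> S w" "e' \<in> S w" for e e' w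
  proof -
    define y y' where "y = point (\<lambda>k. e (k + n))" and "y' = point (\<lambda>k. e' (k + n))"
    have e: "e \<in> symbol_space L" "e' \<in> symbol_space L" "map e [0..<n] = map e' [0..<n]"
      "\<bar>y - point e\<bar> < t" "\<bar>y' - point e'\<bar> < t"
      using that by (auto simp: S_def y_def y'_def)
    have "(\<Sum>k<n. \<rho> ^ k * a (e k)) = (\<Sum>k<n. \<rho> ^ k * a (e' k))"
      using e(3) by (intro sum.cong) auto
    then have "point e - point e' = \<rho> ^ n * (y - y')"
      using point_split[OF e(1), of n] point_split[OF e(2), of n]
      by (simp add: y_def y'_def algebra_simps)
    then have eq: "\<bar>point e - point e'\<bar> = \<rho> ^ n * \<bar>y - y'\<bar>"
      using \<rho> by (simp add: abs_mult)
    have "\<rho> ^ n \<le> \<rho>" using \<rho> n power_decreasing[of 1 n \<rho>] by simp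
    then have *: "\<rho> ^ n * \<bar>y - y'\<bar> \<le> \<rho> * \<bar>y - y'\<bar>" by (rule mult_right_mono) simp
    have "(1 - \<rho>) * \<bar>y - y'\<bar> < 2 * t"
    proof -
      have "\<bar>y - y'\<bar> < 2 * t + \<bar>point e - point e'\<bar>" using e(4,5) by linarith
      with * show ?thesis unfolding eq by (simp add: algebra_simps)
    qed
    then have "\<bar>y - y'\<bar> < 2 * t / (1 - \<rho>)" using \<rho> by (simp add: field_simps)
    then have "\<rho> ^ n * \<bar>y - y'\<bar> < \<rho> ^ n * (2 * t / (1 - \<rho>))"
      using \<rho> by (intro mult_strict_left_mono) auto
    then show ?thesis unfolding eq by (simp add: mult_ac)
  qed
  define W where "W = {w \<in> words L n. S w \<noteq> {}}"
  define P where "P = (\<lambda>w. point (SOME e. e \<in> S w)) ` W"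
  have W: "finite W" "card W \<le> L ^ n"
    unfolding W_def card_words[symmetric] by (auto intro!: card_mono finite_words)
  have pick: "(SOME e. e \<in> S w) \<in> S w" if "w \<in> W" for w
    using that by (auto simp: W_def some_in_eq)
  show ?thesis
  proof (rule that)
    show "finite P" using W by (simp add: P_def)
    show "card P \<le> L ^ n" unfolding P_def using card_image_le[OF W(1)] W(2) by (rule order_trans)
    show "P \<subseteq> K"
    proof
      fix p assume "p \<in> P"
      then obtain w where w: "w \<in> W" "p = point (SOME e. e \<in> S w)" by (auto simp: P_def)
      have "(SOME e. e \<in> S w) \<in> symbol_space L" using pick[OF w(1)] by (simp add: S_def)
      then show "p \<in> K" unfolding w(2) by (rule point_in_K)
    qed
    fix x assume x: "x \<in> K" "\<bar>(shift_map L \<rho> a ^^ n) x - x\<bar> < t"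
    obtain e where e: "e \<in> symbol_space L" "x = point e" using K_coded[OF x(1)] .
    have eS: "e \<in> S (map e [0..<n])"
      using x(2) e by (simp add: S_def shift_map_funpow)
    moreover have "map e [0..<n] \<in> words L n"
      using e(1) by (auto simp: words_def symbol_space_def)
    ultimately have w: "map e [0..<n] \<in> W" by (auto simp: W_def)
    show "\<exists>p\<in>P. dist p x < 2 * \<rho> ^ n * t / (1 - \<rho>)"
      using close[OF pick[OF w] eS] w unfolding P_def e(2) dist_real_def by blast
  qed
qed

text \<open>The countable set \<open>D\<close> comes for free: its first \<open>n + 1\<close> points are added to the centres of level \<open>n\<close>,
which is harmless since \<open>n + 1 \<le> L ^ n\<close>, and each point of \<open>D\<close> is then a centre at all large levels.\<close>
lemma hausdorff_measure_recurrent_set_eq_0: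
  assumes s: "0 < s" and \<psi>: "\<And>n. 1 \<le> n \<Longrightarrow> 0 < \<psi> n"
    and sum: "summable (\<lambda>n. L ^ n * (2 * (2 * \<rho> ^ n * \<psi> n / (1 - \<rho>))) powr s)"
    and D: "countable D" "D \<subseteq> K"
  shows "hausdorff_measure (\<lambda>r. r powr s) K (recurrent_set L \<rho> a K \<psi> \<union> D) = 0"
proof -
  define r where "r n = 2 * \<rho> ^ n * \<psi> n / (1 - \<rho>)" for n
  have r: "0 < r n" if "1 \<le> n" for n using \<rho> \<psi>[OF that] by (simp add: r_def)
  have "\<exists>P. finite P \<and> P \<subseteq> K \<and> card P \<le> L ^ n \<and> (1 \<le> n \<longrightarrow>
      (\<forall>x\<in>K. \<bar>(shift_map L \<rho> a ^^ n) x - x\<bar> < \<psi> n \<longrightarrow> (\<exists>p\<in>P. dist p x < r n)))" for n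
  proof (cases "1 \<le> n")
    case True
    show ?thesis
      by (rule return_set_cover[OF True \<psi>[OF True]], rule exI, unfold r_def) blast
  next
    case False
    then show ?thesis by (intro exI[of _ "{}"]) auto
  qed
  then obtain P where P: "\<And>n. finite (P n)" "\<And>n. P n \<subseteq> K" "\<And>n. card (P n) \<le> L ^ n"
    "\<And>n x. \<lbrakk>1 \<le> n; x \<in> K; \<bar>(shift_map L \<rho> a ^^ n) x - x\<bar> < \<psi> n\<rbrakk> \<Longrightarrow> \<exists>p\<in>P n. dist p x < r n"
    by metis
  define Q where "Q n = (if D = {} then {} else from_nat_into D ` {..n})" for n
  have Q: "finite (Q n)" "Q n \<subseteq> K" "card (Q n) \<le> L ^ n" for n
  proof -
    show "finite (Q n)" "Q n \<subseteq> K" using D(2) from_nat_into[of D] by (auto simp: Q_def)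
    have "card (Q n) \<le> Suc n"
      using card_image_le[of "{..n}" "from_nat_into D"] by (simp add: Q_def)
    also have "\<dots> \<le> 2 ^ n" by (induction n) auto
    also have "\<dots> \<le> L ^ n" using L by (intro power_mono) auto
    finally show "card (Q n) \<le> L ^ n" .
  qed
  show ?thesis
  proof (rule hausdorff_measure_limsup_eq_0[where P = "\<lambda>n. P n \<union> Q n" and r = r])
    show "finite (P n \<union> Q n)" "P n \<union> Q n \<subseteq> K" for n using P Q by auto
    have card: "real (card (P n \<union> Q n)) \<le> 2 * L ^ n" for n
    proof -
      have "card (P n \<union> Q n) \<le> 2 * L ^ n"
        using card_Un_le[of "P n" "Q n"] P(3)[of n] Q(3)[of n] by linarith
      then have "real (card (P n \<union> Q n)) \<le> real (2 * L ^ n)" by (rule of_nat_mono)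
      then show ?thesis by simp
    qed
    show "summable (\<lambda>n. real (card (P n \<union> Q n)) * (2 * r n) powr s)"
    proof (rule summable_comparison_test')
      show "summable (\<lambda>n. 2 * (L ^ n * (2 * r n) powr s))"
        using sum by (intro summable_mult) (simp add: r_def)
      show "norm (real (card (P n \<union> Q n)) * (2 * r n) powr s) \<le> 2 * (L ^ n * (2 * r n) powr s)"
        if "0 \<le> n" for n using mult_right_mono[OF card[of n], of "(2 * r n) powr s"] by simp
    qed
    show "filterlim r (at_right 0) sequentially"
    proof -
      have "(\<lambda>n. (2 * r n) powr s) \<longlonglongrightarrow> 0"
      proof (rule tendsto_sandwich[OF _ _ tendsto_const summable_LIMSEQ_zero[OF sum]])
        have "1 * (2 * r n) powr s \<le> L ^ n * (2 * r n) powr s" for n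
          using L by (intro mult_right_mono) auto
        then show "\<forall>\<^sub>F n in sequentially.
            (2 * r n) powr s \<le> L ^ n * (2 * (2 * \<rho> ^ n * \<psi> n / (1 - \<rho>))) powr s"
          by (simp add: r_def)
      qed auto
      then have "(\<lambda>n. ((2 * r n) powr s) powr (1 / s)) \<longlonglongrightarrow> 0"
        by (rule tendsto_zero_powrI[OF _ tendsto_const]) (use s in auto)
      then have "(\<lambda>n. ((2 * r n) powr s) powr (1 / s) / 2) \<longlonglongrightarrow> 0 / 2"
        by (rule tendsto_divide[OF _ tendsto_const]) simp
      moreover have "\<forall>\<^sub>F n in sequentially. ((2 * r n) powr s) powr (1 / s) / 2 = r n"
        using eventually_ge_at_top[of 1] by eventually_elim (use r s in \<open>simp add: powr_powr less_imp_le\<close>)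
      ultimately have "r \<longlonglongrightarrow> 0" by (simp add: tendsto_cong)
      moreover have "\<forall>\<^sub>F n in sequentially. r n \<in> {0<..} \<and> r n \<noteq> 0"
        using eventually_ge_at_top[of 1] by eventually_elim (use r in force)
      ultimately show ?thesis by (simp add: filterlim_at)
    qed
    show "recurrent_set L \<rho> a K \<psi> \<union> D \<subseteq> K" using D by (auto simp: recurrent_set_def)
    fix x assume "x \<in> recurrent_set L \<rho> a K \<psi> \<union> D"
    then consider "x \<in> recurrent_set L \<rho> a K \<psi>" | "x \<in> D" by blast
    then show "infinite {n. \<exists>p\<in>P n \<union> Q n. dist p x < r n}"
    proof cases
      case 1
      then have "x \<in> K" "infinite {n. 1 \<le> n \<and> \<bar>(shift_map L \<rho> a ^^ n) x - x\<bar> < \<psi> n}"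
        by (auto simp: recurrent_set_def)
      then show ?thesis using P(4) by (elim infinite_super[rotated]) blast
    next
      case 2
      then obtain k where k: "x = from_nat_into D k"
        using D(1) from_nat_into_surj by metis
      have "{max k 1..} \<subseteq> {n. \<exists>p\<in>P n \<union> Q n. dist p x < r n}"
      proof
        fix n assume n: "n \<in> {max k 1..}"
        then have "x \<in> Q n" "0 < r n" using 2 r[of n] by (auto simp: Q_def k)
        then show "n \<in> {n. \<exists>p\<in>P n \<union> Q n. dist p x < r n}" by (intro CollectI bexI[of _ x]) auto
      qed
      then show ?thesis using infinite_Ici infinite_super by blast
    qed
  qed simp
qed

section \<open>Divergence: infinite measure\<close>

lemma cylinder_scale:
  assumes "0 < t" "t \<le> gap * \<rho> ^ l0"
  obtains l where "l0 \<le> l" "gap * \<rho> ^ Suc l < t" "t \<le> gap * \<rho> ^ l"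
proof -
  define l where "l = (LEAST l. gap * \<rho> ^ Suc l < t)"
  obtain l1 where "\<rho> ^ l1 < t / gap"
    using real_arch_pow_inv[of "t / gap" \<rho>] assms gap \<rho> by auto
  then have "gap * \<rho> ^ l1 < t" using gap by (simp add: field_simps)
  moreover have "gap * \<rho> ^ Suc l1 \<le> gap * \<rho> ^ l1"
    using gap \<rho> by (intro mult_left_mono power_decreasing) auto
  ultimately have "gap * \<rho> ^ Suc l1 < t" by linarith
  then have l: "gap * \<rho> ^ Suc l < t" unfolding l_def by (rule LeastI)
  have mono: "gap * \<rho> ^ j \<le> gap * \<rho> ^ i" if "i \<le> j" for i j
    using that gap \<rho> by (intro mult_left_mono power_decreasing) auto
  have l0: "l0 \<le> l"
    using mono[of "Suc l" l0] l assms(2) by (cases "l0 \<le> l") auto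
  have "t \<le> gap * \<rho> ^ l"
  proof (cases l)
    case 0
    then show ?thesis using assms(2) l0 by simp
  next
    case (Suc k)
    then have "k < l" by simp
    then have "\<not> gap * \<rho> ^ Suc k < t" unfolding l_def by (rule not_less_Least)
    then show ?thesis using Suc by simp
  qed
  then show ?thesis using that l l0 by blast
qed

text \<open>A ball of radius at most \<open>gap * \<rho> ^ l\<close> around a point of \<open>K\<close> lies in the cylinder given by the first
\<open>l\<close> symbols of the centre.  A cover by small balls of bounded total cost thus yields a family of
words of finite cost; its total Bernoulli mass is the cost damped by a power of the small size
bound, hence at most one half, and some recurrent sequence avoids all the words.\<close>
lemma fine_covers_of_recurrent_set_cost:
  assumes b: "0 < b" and M: "0 < M"
  obtains \<tau> where "0 < \<tau>"
    "\<And>I x r. ball_cover K \<tau> (recurrent_set L \<rho> a K (\<lambda>n. \<rho> powr (b * real n))) I x r \<Longrightarrow>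
       ennreal M \<le> (\<Sum>i. if i \<in> I then ennreal ((2 * r i) powr (similarity_dim / (1 + b))) else 0)"
proof -
  let ?R = "recurrent_set L \<rho> a K (\<lambda>n. \<rho> powr (b * real n))"
  define s where "s = similarity_dim / (1 + b)"
  have s: "0 < s" using b similarity_dim_pos by (simp add: s_def)
  define C where "C = (gap * \<rho>) powr s"
  have C: "0 < C" using gap \<rho> by (simp add: C_def)
  define q where "q = (1 / L) powr (b / (1 + b))"
  have q: "0 < q" "q < 1"
  proof -
    show "0 < q" using L by (simp add: q_def)
    have "(1 / L) powr (b / (1 + b)) < 1 powr (b / (1 + b))"
      using L b by (intro powr_less_mono2) auto
    then show "q < 1" by (simp add: q_def)
  qed
  \<comment> \<open>\<open>q ^ l0\<close> bounds the ratio of mass to cost for words of length at least \<open>l0\<close>.\<close>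
  obtain l0 where l0: "q ^ l0 < C / (2 * M)"
    using real_arch_pow_inv[of "C / (2 * M)" q] q C M by auto
  show ?thesis
  proof (rule that)
    show "0 < gap * \<rho> ^ l0" using gap \<rho> by simp
    fix I x r
    assume cover: "ball_cover K (gap * \<rho> ^ l0) ?R I x r"
    show "ennreal M \<le> (\<Sum>i. if i \<in> I then ennreal ((2 * r i) powr (similarity_dim / (1 + b))) else 0)"
    proof (rule ccontr)
      assume "\<not> ?thesis"
      then have less: "(\<Sum>i. ennreal (if i \<in> I then (2 * r i) powr s else 0)) < ennreal M"
        by (simp add: s_def if_distrib[of ennreal] not_le cong: if_cong)
      define g where "g i = (if i \<in> I then (2 * r i) powr s else 0)" for i
      have g0: "0 \<le> g i" for i by (simp add: g_def)
      have less: "(\<Sum>i. ennreal (g i)) < ennreal M" using less by (simp add: g_def)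
      then have g: "summable g" by (intro summable_suminf_not_top g0) auto
      have gM: "suminf g < M"
        using less suminf_ennreal2[OF g0 g] M suminf_nonneg[OF g g0] by (simp add: ennreal_less_iff)
      have "\<exists>l e. l0 \<le> l \<and> gap * \<rho> ^ Suc l < r i \<and> r i \<le> gap * \<rho> ^ l \<and>
          e \<in> symbol_space L \<and> x i = point e" if "i \<in> I" for i
      proof -
        have "x i \<in> K" "0 < r i" "r i \<le> gap * \<rho> ^ l0"
          using cover that by (auto simp: ball_cover_def)
        then show ?thesis by (metis K_coded cylinder_scale)
      qed
      then obtain l e where le: "\<And>i. i \<in> I \<Longrightarrow> l0 \<le> l i" "\<And>i. i \<in> I \<Longrightarrow> gap * \<rho> ^ Suc (l i) < r i"
        "\<And>i. i \<in> I \<Longrightarrow> r i \<le> gap * \<rho> ^ l i" "\<And>i. i \<in> I \<Longrightarrow> e i \<in> symbol_space L"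
        "\<And>i. i \<in> I \<Longrightarrow> x i = point (e i)"
        by metis
      define c where "c i = map (e i) [0..<l i]" for i
      have cost: "(1 / L) powr (l i / (1 + b)) \<le> g i / C" if i: "i \<in> I" for i
      proof -
        have "(1 / L) powr (l i / (1 + b)) = (\<rho> ^ l i) powr s"
          unfolding \<rho>_powr_similarity_dim[symmetric] s_def using \<rho>
          by (simp add: powr_powr powr_realpow[symmetric] mult_ac)
        also have "\<dots> = (gap * \<rho> ^ Suc (l i)) powr s / C"
          unfolding C_def using gap \<rho> by (simp add: powr_mult)
        also have "\<dots> \<le> (2 * r i) powr s / C"
        proof (intro divide_right_mono powr_mono2)
          show "0 \<le> gap * \<rho> ^ Suc (l i)" using gap(1) \<rho> by simp
          then show "gap * \<rho> ^ Suc (l i) \<le> 2 * r i" using le(2)[OF i] by linarith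
        qed (use C s in auto)
        finally show ?thesis using i by (simp add: g_def)
      qed
      have mass: "(1 / L) ^ l i \<le> q ^ l0 / C * g i" if i: "i \<in> I" for i
      proof -
        have "(1 / real L) ^ l i = (1 / L) powr (real (l i))"
          using L by (subst powr_realpow) auto
        also have "real (l i) = b / (1 + b) * l i + l i / (1 + b)"
          using b by (simp add: add_divide_distrib[symmetric]) (simp add: field_simps)
        also have "(1 / L) powr (b / (1 + b) * l i + l i / (1 + b)) = q ^ l i * (1 / L) powr (l i / (1 + b))"
          unfolding powr_realpow[OF q(1), symmetric] unfolding q_def by (simp only: powr_add powr_powr)
        also have "\<dots> \<le> q ^ l0 * (g i / C)"
          using cost[OF i] q le(1)[OF i] g0[of i] C
          by (intro mult_mono power_decreasing) auto
        finally show ?thesis by simp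
      qed
      have sum_cost: "summable (\<lambda>i. if i \<in> I then (1 / L) powr (length (c i) / (1 + b)) else 0)"
        by (rule summable_comparison_test'[OF summable_divide[OF g, of C], of 0])
           (use cost g0 C in \<open>auto simp: c_def\<close>)
      have sum_q: "summable (\<lambda>i. q ^ l0 / C * g i)" by (rule summable_mult[OF g])
      have "(\<Sum>i. if i \<in> I then (1 / L) ^ length (c i) else 0) \<le> (\<Sum>i. q ^ l0 / C * g i)"
      proof (intro suminf_le sum_q)
        show *: "(if i \<in> I then (1 / L) ^ length (c i) else 0) \<le> q ^ l0 / C * g i" for i
          using mass[of i] q C g0[of i] by (auto simp: c_def)
        show "summable (\<lambda>i. if i \<in> I then (1 / real L) ^ length (c i) else 0)"
          by (rule summable_comparison_test'[OF sum_q, of 0]) (use * in auto)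
      qed
      also have "\<dots> = q ^ l0 / C * suminf g" by (rule suminf_mult[OF g])
      also have "\<dots> \<le> (C / (2 * M)) / C * M"
        using l0 gM C M q suminf_nonneg[OF g g0]
        by (intro mult_mono divide_right_mono) auto
      also have "\<dots> = 1 / 2" using C M by simp
      finally have small: "(\<Sum>i. if i \<in> I then (1 / L) ^ length (c i) else 0) \<le> (1 / 2 :: real)" .
      interpret sparse_words L b I c
      proof
        show "set (c i) \<subseteq> {1..L}" if "i \<in> I" for i
          using le(4)[OF that] by (auto simp: c_def symbol_space_def)
      qed (fact L b sum_cost)+
      obtain z where z: "z \<in> symbol_space L"
        "infinite {n. 1 \<le> n \<and> (\<forall>k \<le> nat \<lfloor>b * n\<rfloor>. z (k + n) = z k)}"
        "\<forall>i\<in>I. map z [0..<length (c i)] \<noteq> c i"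
        by (rule recurrent_sequence_avoiding_words[OF small])
      have "point z \<in> ?R" unfolding recurrent_set_def
      proof (intro CollectI conjI point_in_K z(1))
        have "\<bar>(shift_map L \<rho> a ^^ n) (point z) - point z\<bar> < \<rho> powr (b * real n)"
          if n: "\<forall>k \<le> nat \<lfloor>b * n\<rfloor>. z (k + n) = z k" for n
        proof -
          have "\<bar>point (\<lambda>k. z (k + n)) - point z\<bar> \<le> \<rho> ^ Suc (nat \<lfloor>b * n\<rfloor>)"
            by (rule dist_point_le[OF symbol_space_shift[OF z(1)] z(1)]) (use n in auto)
          also have "\<dots> = \<rho> powr real (Suc (nat \<lfloor>b * n\<rfloor>))"
            using \<rho> by (simp only: powr_realpow)
          also have "\<dots> < \<rho> powr (b * n)"
          proof (rule powr_less_mono')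
            have "b * n < of_int \<lfloor>b * n\<rfloor> + 1" by linarith
            also have "\<dots> = real (Suc (nat \<lfloor>b * n\<rfloor>))" using b by simp
            finally show "b * n < real (Suc (nat \<lfloor>b * n\<rfloor>))" .
          qed (use \<rho> in auto)
          finally show ?thesis by (simp only: shift_map_funpow[OF z(1)])
        qed
        then show "infinite {n. 1 \<le> n \<and> \<bar>(shift_map L \<rho> a ^^ n) (point z) - point z\<bar> < \<rho> powr (b * real n)}"
          using z(2) by (elim infinite_super[rotated]) blast
      qed
      then obtain i where i: "i \<in> I" "dist (x i) (point z) < r i"
        using cover by (auto simp: ball_cover_def)
      then have "\<bar>point (e i) - point z\<bar> < gap * \<rho> ^ l i"
        using le(3,5)[OF i(1)] by (simp add: dist_real_def)
      then have "e i k = z k" if "k \<le> l i" for k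
        using agree_if_close[OF le(4)[OF i(1)] z(1)] that by blast
      then show False using bspec[OF z(3) i(1)] by (auto simp: c_def)
    qed
  qed
qed

lemma hausdorff_measure_recurrent_set_eq_top:
  assumes b: "0 < b"
  shows "hausdorff_measure (\<lambda>r. r powr (similarity_dim / (1 + b))) K
    (recurrent_set L \<rho> a K (\<lambda>n. \<rho> powr (b * real n))) = \<infinity>"
    (is "hausdorff_measure ?f K ?R = _")
proof -
  have *: "ennreal M \<le> hausdorff_measure ?f K ?R" if M: "0 < M" for M
  proof -
    obtain \<tau> where \<tau>: "0 < \<tau>" "\<And>I x r. ball_cover K \<tau> ?R I x r \<Longrightarrow>
       ennreal M \<le> (\<Sum>i. if i \<in> I then ennreal (?f (2 * r i)) else 0)"
      using fine_covers_of_recurrent_set_cost[OF b M] by blast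
    have "ennreal M \<le> hausdorff_premeasure ?f K \<tau> ?R"
      unfolding hausdorff_premeasure_def by (intro Inf_greatest) (use \<tau>(2) in blast)
    also have "\<dots> \<le> hausdorff_measure ?f K ?R"
      using \<tau>(1) by (rule hausdorff_premeasure_le_measure)
    finally show ?thesis .
  qed
  show ?thesis
  proof (cases "hausdorff_measure ?f K ?R")
    case (real h)
    then show ?thesis using *[of "h + 1"] by (simp add: ennreal_le_iff)
  qed simp
qed

section \<open>Dimension of the attractor\<close>

text \<open>With the constant rate 2 every point of \<open>K\<close> is recurrent, since \<open>K\<close> has diameter at most 1.  The
constant 8 below is the product of this rate with the factor 4 that the cover of a return set
contributes to the diameters.\<close>
lemma hausdorff_measure_K_eq_0:
  assumes s: "similarity_dim < s"
  shows "hausdorff_measure (\<lambda>r. r powr s) K K = 0"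
proof -
  have "\<bar>(shift_map L \<rho> a ^^ n) x - x\<bar> < 2" if x: "x \<in> K" for n x
  proof -
    obtain e where e: "e \<in> symbol_space L" "x = point e" using K_coded[OF x] .
    show ?thesis
      using point_bounds[OF e(1)] point_bounds[OF symbol_space_shift[OF e(1), of n]]
      unfolding e(2) shift_map_funpow[OF e(1)] by linarith
  qed
  then have "recurrent_set L \<rho> a K (\<lambda>n. 2) = K"
    using infinite_Ici[of "1::nat"] by (auto simp: recurrent_set_def atLeast_def)
  moreover have "hausdorff_measure (\<lambda>r. r powr s) K (recurrent_set L \<rho> a K (\<lambda>n. 2) \<union> {}) = 0"
  proof (rule hausdorff_measure_recurrent_set_eq_0)
    have "L * \<rho> powr s < L * \<rho> powr similarity_dim"
      using L \<rho> s by (intro mult_strict_left_mono powr_less_mono') auto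
    then have "L * \<rho> powr s < 1" using L by (simp add: \<rho>_powr_similarity_dim)
    then have "summable (\<lambda>n. (8 / (1 - \<rho>)) powr s * (L * \<rho> powr s) ^ n)"
      by (intro summable_mult summable_geometric) auto
    moreover have "L ^ n * (2 * (2 * \<rho> ^ n * 2 / (1 - \<rho>))) powr s =
        (8 / (1 - \<rho>)) powr s * (L * \<rho> powr s) ^ n" for n
    proof -
      have "(2 * (2 * \<rho> ^ n * 2 / (1 - \<rho>))) powr s = (8 / (1 - \<rho>) * \<rho> ^ n) powr s"
        by (simp add: field_simps)
      also have "\<dots> = (8 / (1 - \<rho>)) powr s * (\<rho> ^ n) powr s"
        by (rule powr_mult)
      also have "(\<rho> ^ n) powr s = (\<rho> powr s) ^ n"
        using \<rho> by (simp add: powr_realpow[symmetric] powr_powr mult_ac)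
      finally show ?thesis by (simp add: power_mult_distrib)
    qed
    ultimately show "summable (\<lambda>n. L ^ n * (2 * (2 * \<rho> ^ n * 2 / (1 - \<rho>))) powr s)" by simp
    show "0 < s" using similarity_dim_pos s by linarith
  qed auto
  ultimately show ?thesis by simp
qed

text \<open>For the lower bound, an exponent \<open>s\<close> below the similarity dimension has the form
\<open>similarity_dim / (1 + b)\<close> with \<open>b > 0\<close>, and then already a subset of \<open>K\<close> has infinite measure.\<close>
lemma hausdorff_dim_K: "hausdorff_dim K = similarity_dim"
proof -
  define S where "S = {s. 0 < s \<and> hausdorff_measure (\<lambda>r. r powr s) K K = 0}"
  have above: "s \<in> S" if "similarity_dim < s" for s
    using that hausdorff_measure_K_eq_0 similarity_dim_pos by (auto simp: S_def)
  have below: "similarity_dim \<le> s" if s: "s \<in> S" for s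
  proof (rule ccontr)
    assume less: "\<not> similarity_dim \<le> s"
    define b where "b = similarity_dim / s - 1"
    have "0 < s" using s by (simp add: S_def)
    then have b: "0 < b" "similarity_dim / (1 + b) = s"
      using less similarity_dim_pos by (auto simp: b_def)
    have "hausdorff_measure (\<lambda>r. r powr s) K (recurrent_set L \<rho> a K (\<lambda>n. \<rho> powr (b * real n)))
        \<le> hausdorff_measure (\<lambda>r. r powr s) K K"
      by (rule hausdorff_measure_mono) (auto simp: recurrent_set_def)
    then show False
      using hausdorff_measure_recurrent_set_eq_top[OF b(1)] s by (simp add: b(2) S_def)
  qed
  have "Inf S = similarity_dim"
  proof (rule antisym)
    show "Inf S \<le> similarity_dim"
    proof (rule field_le_epsilon)
      fix \<epsilon> :: real assume "0 < \<epsilon>"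
      then show "Inf S \<le> similarity_dim + \<epsilon>"
        by (intro cInf_lower above) (auto intro!: bdd_belowI[of _ similarity_dim] below)
    qed
    show "similarity_dim \<le> Inf S"
      using above[of "similarity_dim + 1"] below by (intro cInf_greatest) auto
  qed
  then show ?thesis by (simp add: hausdorff_dim_def S_def)
qed

section \<open>The logarithmic rate and the difference set\<close>

text \<open>The exponent of the logarithm, multiplied by \<open>similarity_dim / (1 + b)\<close>, is \<open>- (1 + \<eta>)\<close>, while
\<open>L ^ n\<close> cancels against the powers of \<open>\<rho>\<close>; what remains is a multiple of
\<open>n powr (- (1 + \<eta>))\<close>.\<close>
lemma hausdorff_measure_log_recurrent_set_eq_0:
  assumes b: "0 < b" and \<eta>: "0 < \<eta>" and D: "countable D" "D \<subseteq> K"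
  shows "hausdorff_measure (\<lambda>r. r powr (similarity_dim / (1 + b))) K
    (recurrent_set L \<rho> a K (\<lambda>n. \<rho> powr (b * real n) *
       ln (\<rho> powr (- real n)) powr (- ((1 + b) * (1 + \<eta>) / similarity_dim))) \<union> D) = 0"
proof (rule hausdorff_measure_recurrent_set_eq_0[OF _ _ _ D])
  define s where "s = similarity_dim / (1 + b)"
  define \<kappa> where "\<kappa> = (1 + b) * (1 + \<eta>) / similarity_dim"
  let ?\<psi> = "\<lambda>n. \<rho> powr (b * real n) * ln (\<rho> powr (- real n)) powr (- \<kappa>)"
  have ln: "ln (\<rho> powr (- real n)) = real n * (- ln \<rho>)" for n
    using \<rho> by (simp add: ln_powr)
  have c: "0 < - ln \<rho>" using \<rho> by simp
  show "0 < similarity_dim / (1 + b)" using b similarity_dim_pos by simp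
  show "0 < \<rho> powr (b * real n) * ln (\<rho> powr (- real n)) powr (- ((1 + b) * (1 + \<eta>) / similarity_dim))"
    if "1 \<le> n" for n
  proof -
    have "real n * (- ln \<rho>) \<noteq> 0" using that c by simp
    then show ?thesis unfolding ln using \<rho> by simp
  qed
  have "L ^ n * (2 * (2 * \<rho> ^ n * ?\<psi> n / (1 - \<rho>))) powr s =
      (4 / (1 - \<rho>)) powr s * (- ln \<rho>) powr (- (1 + \<eta>)) * real n powr (- (1 + \<eta>))" for n
  proof -
    have radius: "2 * (2 * \<rho> ^ n * ?\<psi> n / (1 - \<rho>)) =
        4 / (1 - \<rho>) * \<rho> powr (real n * (1 + b)) * (real n * (- ln \<rho>)) powr (- \<kappa>)"
      unfolding ln using \<rho> by (simp add: powr_realpow[symmetric] powr_add[symmetric] algebra_simps)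
    have "(\<rho> powr (real n * (1 + b))) powr s = (\<rho> powr similarity_dim) powr n"
      using b by (simp add: powr_powr s_def mult_ac)
    then have exp_part: "(\<rho> powr (real n * (1 + b))) powr s = (1 / L) ^ n"
      unfolding \<rho>_powr_similarity_dim using L by (simp add: powr_realpow)
    have "\<kappa> * s = 1 + \<eta>"
      using b similarity_dim_pos by (simp add: \<kappa>_def s_def)
    then have "((real n * (- ln \<rho>)) powr (- \<kappa>)) powr s = (real n * (- ln \<rho>)) powr (- (1 + \<eta>))"
      by (simp only: powr_powr mult_minus_left)
    then have log_part: "((real n * (- ln \<rho>)) powr (- \<kappa>)) powr s =
        real n powr (- (1 + \<eta>)) * (- ln \<rho>) powr (- (1 + \<eta>))"
      by (simp only: powr_mult)
    have "(2 * (2 * \<rho> ^ n * ?\<psi> n / (1 - \<rho>))) powr s = (4 / (1 - \<rho>)) powr s *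
        (\<rho> powr (real n * (1 + b))) powr s * ((real n * (- ln \<rho>)) powr (- \<kappa>)) powr s"
      unfolding radius by (simp only: powr_mult)
    then have "(2 * (2 * \<rho> ^ n * ?\<psi> n / (1 - \<rho>))) powr s = (4 / (1 - \<rho>)) powr s *
        (1 / L) ^ n * (real n powr (- (1 + \<eta>)) * (- ln \<rho>) powr (- (1 + \<eta>)))"
      unfolding exp_part log_part .
    then show ?thesis using L by (simp add: power_one_over mult_ac)
  qed
  moreover have "summable (\<lambda>n. real n powr (- (1 + \<eta>)))"
    using \<eta> by (simp add: summable_real_powr_iff)
  ultimately show "summable (\<lambda>n. L ^ n * (2 * (2 * \<rho> ^ n * (\<rho> powr (b * real n) *
       ln (\<rho> powr (- real n)) powr (- ((1 + b) * (1 + \<eta>) / similarity_dim))) / (1 - \<rho>))) powr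
       (similarity_dim / (1 + b)))"
    unfolding s_def[symmetric] \<kappa>_def[symmetric] by (simp add: summable_mult)
qed

end

theorem corollary1p9:
  fixes L :: nat and \<rho> b \<eta> \<gamma> :: real and a :: "nat \<Rightarrow> real" and K :: "real set"
    and f :: "real \<Rightarrow> real" and \<phi> \<phi>\<^sub>\<eta> :: "nat \<Rightarrow> real"
  assumes "2 \<le> L"
    and "0 < \<rho>" and "\<rho> < 1"
    and "0 \<le> a 1" and "strict_mono_on {1..L} a" and "a L \<le> 1 - \<rho>"
    and "is_attractor L \<rho> a K"
    and "strong_separation L \<rho> a K"
    and "\<gamma> = hausdorff_dim K"
    and "0 < b" and "0 < \<eta>"
    and "f = (\<lambda>r. r powr (\<gamma> / (1 + b)))"
    and "\<phi> = (\<lambda>n. \<rho> powr (b * real n))"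
    and "\<phi>\<^sub>\<eta> = (\<lambda>n. \<rho> powr (b * real n) *
           ln (\<rho> powr (- real n)) powr (- ((1 + b) * (1 + \<eta>) / \<gamma>)))"
  shows "\<gamma> = ln (real L) / (- ln \<rho>) \<and>
    hausdorff_measure f K (recurrent_set L \<rho> a K \<phi>) = \<infinity> \<and>
    hausdorff_measure f K (recurrent_set L \<rho> a K \<phi>\<^sub>\<eta>) = 0 \<and>
    uncountable (recurrent_set L \<rho> a K \<phi> - recurrent_set L \<rho> a K \<phi>\<^sub>\<eta>)"
proof -
  interpret separated_ifs L \<rho> a K
  proof
    fix j assume j: "j \<in> {1..L}"
    have "a 1 \<le> a j" "a j \<le> a L"
      using j by (auto intro!: monotone_onD[OF strict_mono_on_imp_mono_on[OF assms(5)]])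
    then show "0 \<le> a j \<and> a j \<le> 1 - \<rho>" using assms(4,6) by linarith
  qed (fact assms)+
  have \<gamma>: "\<gamma> = similarity_dim" using assms(9) hausdorff_dim_K by simp
  have top: "hausdorff_measure f K (recurrent_set L \<rho> a K \<phi>) = \<infinity>"
    unfolding assms(12,13) \<gamma> by (rule hausdorff_measure_recurrent_set_eq_top[OF assms(10)])
  have null: "hausdorff_measure f K (recurrent_set L \<rho> a K \<phi>\<^sub>\<eta> \<union> D) = 0"
    if "countable D" "D \<subseteq> K" for D
    unfolding assms(12,14) \<gamma>
    by (rule hausdorff_measure_log_recurrent_set_eq_0[OF assms(10,11) that])
  have "uncountable (recurrent_set L \<rho> a K \<phi> - recurrent_set L \<rho> a K \<phi>\<^sub>\<eta>)" (is "uncountable ?D")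
  proof
    assume D: "countable ?D"
    have "hausdorff_measure f K (recurrent_set L \<rho> a K \<phi>) \<le>
        hausdorff_measure f K (recurrent_set L \<rho> a K \<phi>\<^sub>\<eta> \<union> ?D)"
      by (rule hausdorff_measure_mono) blast
    also have "\<dots> = 0" by (rule null[OF D]) (auto simp: recurrent_set_def)
    finally show False using top by simp
  qed
  then show ?thesis using top null[of "{}"] \<gamma> by (simp add: similarity_dim_def)
qed

end
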